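(* Let $S\colon P\to\mathsf{Set}$ be a persistent set over a finite poset $P$. (1) Every rooted subset $A$ of $S$ induces a summand in the decomposition of $\mathcal{L}S$: if $\varphi$ is an idempotent endomorphism of $S$ whose set of non-fixed generators is exactly $A$, then the nonzero persistence module $\operatorname{img}(\mathrm{id}_{\mathcal{L}S}-\mathcal{L}\varphi)$ is a direct summand of $\mathcal{L}S$. (2) If $x\in S_{p_x}$ is a rooted generator and $\varphi$ is an idempotent endomorphism of $S$ whose only non-fixed generator is $x$, then the summand $\operatorname{img}(\mathrm{id}_{\mathcal{L}S}-\mathcal{L}\varphi)$ is isomorphic to an interval module, and all other summands in the decomposition of $\mathcal{L}S$ into indecomposables are obtained by decomposing $\mathcal{L}(\operatorname{img}\varphi)$ into indecomposables.
   Context: Let $P$ be a finite poset, viewed as a category. A persistent set over $P$ is a functor $S\colon P\to\mathsf{Set}$ to finite sets, with maps $S_{p\to q}\colon S_p\to S_q$ for $p\le q$; a persistence module over $P$ is a functor $P\to\mathsf{Vec}$ to finite-dimensional vector spaces over a fixed field $K$. Morphisms are natural transformations. Images of morphisms are taken pointwise: $(\operatorname{img} f)_p=\operatorname{img}(f_p)$. An endomorphism $\varphi$ is idempotent if $\varphi\circ\varphi=\varphi$. The linearization functor $\mathcal{L}$ from persistent sets to persistence modules is postcomposition with the functor taking a finite set to the free $K$-vector space on it. Direct sums of persistence modules are pointwise; a persistence module $F$ is indecomposable if $F\cong F_1\oplus F_2$ implies $F_1=0$ or $F_2=0$. Decompositions into nonzero indecomposables are unique up to permutation and isomorphism of the summands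 (Krull-Schmidt). Let $I\subseteq P$ be a non-empty connected subposet such that $i\le l\le j$ with $i,j\in I$, $l\in P$ implies $l\in I$. The interval module supported on $I$ is the persistence module with value $K$ at $p\in I$ and $0$ at $p\notin I$, whose internal maps $p\to q$ are the identity if $p,q\in I$ and zero otherwise. A generator of $S$ is a pair $(p_x,x)$ with $x\in S_{p_x}$ such that $x$ is not in the image of $S_{q\to p_x}$ for any $q<p_x$; one often writes just $x$. A generator $(p_x,x)$ is fixed by an endomorphism $\varphi$ of $S$ if $\varphi_{p_x}(x)=x$. A rooted subset of $S$ is a non-empty subset $A$ of the generators of $S$ such that there is an idempotent endomorphism $\varphi$ of $S$ whose set of generators that are not fixed is precisely $A$. If $A=\{x\}$ is a rooted subset, $x$ is called a rooted generator. *)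

theory Defs
  imports "HOL.Vector_Spaces" "HOL-Library.Function_Algebras" "HOL-Library.Product_Plus"
begin

section \<open>Persistent sets\<close>

text \<open>
  The finite poset is a type of class \<open>finite\<close> and \<open>order\<close>.  All the sets of a
  persistent set are subsets of one type; they need not be disjoint.  The map at \<open>p\<close>, \<open>q\<close>
  matters only for \<open>p \<le> q\<close>, and only on the set at \<open>p\<close>.
\<close>

record ('p, 'a) pset =
  ps_at :: "'p \<Rightarrow> 'a set"
  ps_map :: "'p \<Rightarrow> 'p \<Rightarrow> 'a \<Rightarrow> 'a"

definition persistent_set :: "('p::{finite,order}, 'a) pset \<Rightarrow> bool" where
  "persistent_set S \<longleftrightarrow>
     (\<forall>p. finite (ps_at S p)) \<and>
     (\<forall>p q. p \<le> q \<longrightarrow> ps_map S p q ` ps_at S p \<subseteq> ps_at S q) \<and>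
     (\<forall>p. \<forall>x \<in> ps_at S p. ps_map S p p x = x) \<and>
     (\<forall>p q r. p \<le> q \<longrightarrow> q \<le> r \<longrightarrow>
        (\<forall>x \<in> ps_at S p. ps_map S q r (ps_map S p q x) = ps_map S p r x))"

definition ps_hom ::
  "('p::{finite,order}, 'a) pset \<Rightarrow> ('p, 'b) pset \<Rightarrow> ('p \<Rightarrow> 'a \<Rightarrow> 'b) \<Rightarrow> bool" where
  "ps_hom S T f \<longleftrightarrow>
     persistent_set S \<and> persistent_set T \<and>
     (\<forall>p. f p ` ps_at S p \<subseteq> ps_at T p) \<and>
     (\<forall>p q. p \<le> q \<longrightarrow> (\<forall>x \<in> ps_at S p. f q (ps_map S p q x) = ps_map T p q (f p x)))"

definition ps_idempotent_endo ::
  "('p::{finite,order}, 'a) pset \<Rightarrow> ('p \<Rightarrow> 'a \<Rightarrow> 'a) \<Rightarrow> bool" where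
  "ps_idempotent_endo S \<phi> \<longleftrightarrow>
     ps_hom S S \<phi> \<and> (\<forall>p. \<forall>x \<in> ps_at S p. \<phi> p (\<phi> p x) = \<phi> p x)"

text \<open>The image of a morphism \<open>f\<close> from \<open>S\<close> to \<open>T\<close>, with the maps of \<open>T\<close> restricted to it.\<close>

definition ps_image ::
  "('p \<Rightarrow> 'a \<Rightarrow> 'b) \<Rightarrow> ('p, 'a) pset \<Rightarrow> ('p, 'b) pset \<Rightarrow> ('p, 'b) pset" where
  "ps_image f S T = T\<lparr>ps_at := \<lambda>p. f p ` ps_at S p\<rparr>"

definition generators :: "('p::{finite,order}, 'a) pset \<Rightarrow> ('p \<times> 'a) set" where
  "generators S = {(p, x). x \<in> ps_at S p \<and> (\<forall>q<p. x \<notin> ps_map S q p ` ps_at S q)}"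

definition nonfixed_generators ::
  "('p::{finite,order}, 'a) pset \<Rightarrow> ('p \<Rightarrow> 'a \<Rightarrow> 'a) \<Rightarrow> ('p \<times> 'a) set" where
  "nonfixed_generators S \<phi> = {(p, x) \<in> generators S. \<phi> p x \<noteq> x}"

definition rooted_subset :: "('p::{finite,order}, 'a) pset \<Rightarrow> ('p \<times> 'a) set \<Rightarrow> bool" where
  "rooted_subset S A \<longleftrightarrow>
     A \<noteq> {} \<and> A \<subseteq> generators S \<and>
     (\<exists>\<phi>. ps_idempotent_endo S \<phi> \<and> nonfixed_generators S \<phi> = A)"

definition rooted_generator :: "('p::{finite,order}, 'a) pset \<Rightarrow> 'p \<Rightarrow> 'a \<Rightarrow> bool" where
  "rooted_generator S p x \<longleftrightarrow> rooted_subset S {(p, x)}"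


section \<open>Persistence modules\<close>

text \<open>
  The vector spaces of a persistence module are finite-dimensional subspaces of one ambient
  vector space (the type \<open>'v\<close> with scalar multiplication \<open>pm_scale\<close>).  This loses no
  generality: the direct sum of all the given spaces can serve as the ambient space.  As for
  persistent sets, the maps matter only for \<open>p \<le> q\<close> and only on the space at \<open>p\<close>.
\<close>

record ('p, 'k, 'v) pmod =
  pm_scale :: "'k \<Rightarrow> 'v \<Rightarrow> 'v"
  pm_at :: "'p \<Rightarrow> 'v set"
  pm_map :: "'p \<Rightarrow> 'p \<Rightarrow> 'v \<Rightarrow> 'v"

definition linear_map_on ::
  "('k \<Rightarrow> 'v::plus \<Rightarrow> 'v) \<Rightarrow> ('k \<Rightarrow> 'w::plus \<Rightarrow> 'w) \<Rightarrow> 'v set \<Rightarrow> 'w set \<Rightarrow> ('v \<Rightarrow> 'w) \<Rightarrow> bool" where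
  "linear_map_on s t V W f \<longleftrightarrow>
     f ` V \<subseteq> W \<and>
     (\<forall>v \<in> V. \<forall>w \<in> V. f (v + w) = f v + f w) \<and>
     (\<forall>c. \<forall>v \<in> V. f (s c v) = t c (f v))"

definition persistence_module ::
  "('p::{finite,order}, 'k::field, 'v::ab_group_add) pmod \<Rightarrow> bool" where
  "persistence_module M \<longleftrightarrow>
     vector_space (pm_scale M) \<and>
     (\<forall>p. module.subspace (pm_scale M) (pm_at M p)) \<and>
     (\<forall>p. \<exists>B. finite B \<and> module.span (pm_scale M) B = pm_at M p) \<and>
     (\<forall>p q. p \<le> q \<longrightarrow>
        linear_map_on (pm_scale M) (pm_scale M) (pm_at M p) (pm_at M q) (pm_map M p q)) \<and>
     (\<forall>p. \<forall>v \<in> pm_at M p. pm_map M p p v = v) \<and>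
     (\<forall>p q r. p \<le> q \<longrightarrow> q \<le> r \<longrightarrow>
        (\<forall>v \<in> pm_at M p. pm_map M q r (pm_map M p q v) = pm_map M p r v))"

definition pm_zero :: "('p, 'k, 'v::zero) pmod \<Rightarrow> bool" where
  "pm_zero M \<longleftrightarrow> (\<forall>p. pm_at M p = {0})"

definition pm_hom ::
  "('p::{finite,order}, 'k::field, 'v::ab_group_add) pmod \<Rightarrow> ('p, 'k, 'w::ab_group_add) pmod \<Rightarrow>
     ('p \<Rightarrow> 'v \<Rightarrow> 'w) \<Rightarrow> bool" where
  "pm_hom M N f \<longleftrightarrow>
     persistence_module M \<and> persistence_module N \<and>
     (\<forall>p. linear_map_on (pm_scale M) (pm_scale N) (pm_at M p) (pm_at N p) (f p)) \<and>
     (\<forall>p q. p \<le> q \<longrightarrow> (\<forall>v \<in> pm_at M p. f q (pm_map M p q v) = pm_map N p q (f p v)))"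

definition pm_iso ::
  "('p::{finite,order}, 'k::field, 'v::ab_group_add) pmod \<Rightarrow> ('p, 'k, 'w::ab_group_add) pmod \<Rightarrow>
     ('p \<Rightarrow> 'v \<Rightarrow> 'w) \<Rightarrow> bool" where
  "pm_iso M N f \<longleftrightarrow> pm_hom M N f \<and> (\<forall>p. bij_betw (f p) (pm_at M p) (pm_at N p))"

definition pm_isomorphic ::
  "('p::{finite,order}, 'k::field, 'v::ab_group_add) pmod \<Rightarrow> ('p, 'k, 'w::ab_group_add) pmod \<Rightarrow>
     bool" (infix \<open>\<cong>\<^sub>p\<^sub>m\<close> 50) where
  "M \<cong>\<^sub>p\<^sub>m N \<longleftrightarrow> (\<exists>f. pm_iso M N f)"

definition pm_image ::
  "('p \<Rightarrow> 'v \<Rightarrow> 'w) \<Rightarrow> ('p, 'k, 'v) pmod \<Rightarrow> ('p, 'k, 'w) pmod \<Rightarrow> ('p, 'k, 'w) pmod" where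
  "pm_image f M N = N\<lparr>pm_at := \<lambda>p. f p ` pm_at M p\<rparr>"


subsection \<open>Direct sums and decompositions\<close>

definition pm_sum ::
  "('p, 'k, 'v) pmod \<Rightarrow> ('p, 'k, 'w) pmod \<Rightarrow> ('p, 'k, 'v \<times> 'w) pmod" (infixr \<open>\<oplus>\<^sub>p\<^sub>m\<close> 65) where
  "M \<oplus>\<^sub>p\<^sub>m N =
     \<lparr>pm_scale = \<lambda>c (v, w). (pm_scale M c v, pm_scale N c w),
      pm_at = \<lambda>p. pm_at M p \<times> pm_at N p,
      pm_map = \<lambda>p q (v, w). (pm_map M p q v, pm_map N p q w)\<rparr>"

text \<open>
  The direct sum of a list of persistence modules with common scalar multiplication \<open>s\<close>.
  A vector of the sum is a sequence whose \<open>i\<close>-th entry lies in the \<open>i\<close>-th summand and which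
  vanishes beyond the length of the list; the sum of the empty list is the zero module.
\<close>

definition pm_list_sum ::
  "('k \<Rightarrow> 'v::ab_group_add \<Rightarrow> 'v) \<Rightarrow> ('p, 'k, 'v) pmod list \<Rightarrow> ('p, 'k, nat \<Rightarrow> 'v) pmod" where
  "pm_list_sum s Ms =
     \<lparr>pm_scale = \<lambda>c v i. s c (v i),
      pm_at = \<lambda>p. {v. (\<forall>i < length Ms. v i \<in> pm_at (Ms ! i) p) \<and> (\<forall>i \<ge> length Ms. v i = 0)},
      pm_map = \<lambda>p q v i. if i < length Ms then pm_map (Ms ! i) p q (v i) else 0\<rparr>"

text \<open>
  The summands \<open>F1\<close> and \<open>F2\<close> range over modules with the ambient type of \<open>F\<close>.  This is
  no restriction, because direct summands of \<open>F\<close> are isomorphic to submodules of \<open>F\<close>.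
\<close>

definition pm_indecomposable ::
  "('p::{finite,order}, 'k::field, 'v::ab_group_add) pmod \<Rightarrow> bool" where
  "pm_indecomposable F \<longleftrightarrow>
     persistence_module F \<and>
     (\<forall>(F1 :: ('p, 'k, 'v) pmod) (F2 :: ('p, 'k, 'v) pmod).
        persistence_module F1 \<longrightarrow> persistence_module F2 \<longrightarrow> F \<cong>\<^sub>p\<^sub>m F1 \<oplus>\<^sub>p\<^sub>m F2 \<longrightarrow>
        pm_zero F1 \<or> pm_zero F2)"

text \<open>
  \<open>Gs\<close> lists the summands of a decomposition of \<open>M\<close> into nonzero indecomposables, all with
  the scalar multiplication \<open>s\<close>.
\<close>

definition pm_decomposition ::
  "('k \<Rightarrow> 'w \<Rightarrow> 'w) \<Rightarrow> ('p::{finite,order}, 'k::field, 'v::ab_group_add) pmod \<Rightarrow>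
     ('p, 'k, 'w::ab_group_add) pmod list \<Rightarrow> bool" where
  "pm_decomposition s M Gs \<longleftrightarrow>
     (\<forall>G \<in> set Gs. pm_scale G = s \<and> pm_indecomposable G \<and> \<not> pm_zero G) \<and>
     M \<cong>\<^sub>p\<^sub>m pm_list_sum s Gs"

definition pm_submodule ::
  "('p::{finite,order}, 'k::field, 'v::ab_group_add) pmod \<Rightarrow> ('p, 'k, 'v) pmod \<Rightarrow> bool" where
  "pm_submodule N M \<longleftrightarrow>
     persistence_module N \<and> persistence_module M \<and> pm_scale N = pm_scale M \<and>
     (\<forall>p. pm_at N p \<subseteq> pm_at M p) \<and>
     (\<forall>p q. p \<le> q \<longrightarrow> (\<forall>v \<in> pm_at N p. pm_map N p q v = pm_map M p q v))"

definition pm_direct_summand ::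
  "('p::{finite,order}, 'k::field, 'v::ab_group_add) pmod \<Rightarrow> ('p, 'k, 'v) pmod \<Rightarrow> bool" where
  "pm_direct_summand N M \<longleftrightarrow>
     pm_submodule N M \<and>
     (\<exists>C. pm_submodule C M \<and> pm_iso (N \<oplus>\<^sub>p\<^sub>m C) M (\<lambda>p (v, w). v + w))"


subsection \<open>Interval modules\<close>

definition interval_subposet :: "'p::{finite,order} set \<Rightarrow> bool" where
  "interval_subposet I \<longleftrightarrow>
     I \<noteq> {} \<and>
     (\<forall>i \<in> I. \<forall>j \<in> I. (i, j) \<in> {(a, b). a \<in> I \<and> b \<in> I \<and> (a \<le> b \<or> b \<le> a)}\<^sup>*) \<and>
     (\<forall>i \<in> I. \<forall>j \<in> I. \<forall>l. i \<le> l \<longrightarrow> l \<le> j \<longrightarrow> l \<in> I)"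

definition interval_module :: "'p set \<Rightarrow> ('p, 'k::field, 'k) pmod" where
  "interval_module I =
     \<lparr>pm_scale = (*),
      pm_at = \<lambda>p. if p \<in> I then UNIV else {0},
      pm_map = \<lambda>p q v. if p \<in> I \<and> q \<in> I then v else 0\<rparr>"


section \<open>Linearization\<close>

text \<open>
  The free vector space on a finite set \<open>X\<close> is the space of functions that vanish outside
  \<open>X\<close>; \<open>free_map X f\<close> is the linear extension of \<open>f\<close>, which sends the indicator function of
  \<open>x\<close> to that of \<open>f x\<close>.
\<close>

definition free_space :: "'a set \<Rightarrow> ('a \<Rightarrow> 'k::field) set" where
  "free_space X = {v. \<forall>x. x \<notin> X \<longrightarrow> v x = 0}"

definition free_map :: "'a set \<Rightarrow> ('a \<Rightarrow> 'b) \<Rightarrow> ('a \<Rightarrow> 'k::field) \<Rightarrow> 'b \<Rightarrow> 'k" where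
  "free_map X f v = (\<lambda>y. \<Sum>x \<in> {x \<in> X. f x = y}. v x)"

definition linearization :: "('p, 'a) pset \<Rightarrow> ('p, 'k::field, 'a \<Rightarrow> 'k) pmod" where
  "linearization S =
     \<lparr>pm_scale = \<lambda>c v x. c * v x,
      pm_at = \<lambda>p. free_space (ps_at S p),
      pm_map = \<lambda>p q. free_map (ps_at S p) (ps_map S p q)\<rparr>"

definition linearization_hom ::
  "('p, 'a) pset \<Rightarrow> ('p \<Rightarrow> 'a \<Rightarrow> 'b) \<Rightarrow> 'p \<Rightarrow> ('a \<Rightarrow> 'k::field) \<Rightarrow> 'b \<Rightarrow> 'k" where
  "linearization_hom S f p = free_map (ps_at S p) (f p)"

text \<open>The image of \<open>id - L \<phi>\<close>, where \<open>L \<phi>\<close> is the linearization of the endomorphism \<open>\<phi>\<close>.\<close>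

definition complement_image ::
  "('p, 'a) pset \<Rightarrow> ('p \<Rightarrow> 'a \<Rightarrow> 'a) \<Rightarrow> ('p, 'k::field, 'a \<Rightarrow> 'k) pmod" where
  "complement_image S \<phi> =
     pm_image (\<lambda>p v. v - linearization_hom S \<phi> p v) (linearization S) (linearization S)"

end

theory Submission
  imports Defs
begin

text \<open>
  If \<open>\<phi>\<close> is an idempotent endomorphism of \<open>S\<close>, then \<open>L \<phi>\<close> is an idempotent endomorphism of
  \<open>L S\<close>, so \<open>L S\<close> is the direct sum of the images of \<open>1 - L \<phi>\<close> and of \<open>L \<phi>\<close>
  (\<open>idempotent_direct_summand\<close>), and the second of these is \<open>L (img \<phi>)\<close>
  (\<open>linearization_biproduct\<close>).  A generator \<open>x\<close> that is moved by \<open>\<phi>\<close> yields the nonzero vector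
  \<open>x - \<phi> x\<close> in the first summand.

  Suppose that \<open>x\<close>, in degree \<open>p\<close>, is the only generator that is moved.  An element of \<open>S\<close> is moved
  only if it is the image of a moved generator, hence only if it is the image of \<open>x\<close>.  The
  summand \<open>N = img (1 - L \<phi>)\<close> is therefore generated by the single vector \<open>x - \<phi> x\<close>
  (\<open>complement_image_cyclic\<close>).  A module with one generator has dimension at most one in each
  degree; it is the interval module of its support (\<open>pm_cyclic_interval_module\<close>), and it is
  indecomposable because in a direct sum the generator would lie in one of the summands
  (\<open>pm_cyclic_indecomposable\<close>).

  A decomposition of \<open>L (img \<phi>)\<close> is completed to one of \<open>L S\<close> by adding \<open>N\<close>
  (\<open>pm_decomposition_Cons\<close>).  Conversely, let \<open>L S\<close> be decomposed into indecomposables.  Since the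
  endomorphisms of \<open>N\<close> are scalars, the part of the Krull-Schmidt theorem that is required here
  has a short proof (\<open>cyclic_summand_exchange\<close>): the identity of \<open>N\<close> is a sum of endomorphisms
  that factor through the given indecomposables, one of these is a nonzero scalar, and so \<open>N\<close> is
  a retract of an indecomposable \<open>G\<close>, that is, \<open>N \<cong> G\<close>.  The other indecomposables together and
  \<open>L (img \<phi>)\<close> are then both complements of the same submodule \<open>N\<close> of \<open>L S\<close>, hence isomorphic
  (\<open>pm_biproduct_cancel\<close>).
\<close>

section \<open>Persistence modules and their morphisms\<close>

lemma pm_vector_space: "persistence_module M \<Longrightarrow> vector_space (pm_scale M)"
  by (simp add: persistence_module_def)

lemma pm_subspace: "persistence_module M \<Longrightarrow> module.subspace (pm_scale M) (pm_at M p)"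
  by (simp add: persistence_module_def)

lemma pm_finite_dimensional:
  "persistence_module M \<Longrightarrow> \<exists>B. finite B \<and> module.span (pm_scale M) B = pm_at M p"
  by (simp add: persistence_module_def)

lemma pm_module: "persistence_module M \<Longrightarrow> module (pm_scale M)"
  by (simp add: pm_vector_space module_iff_vector_space)

lemma pm_zero_in: "persistence_module M \<Longrightarrow> 0 \<in> pm_at M p"
  by (rule module.subspace_0[OF pm_module pm_subspace])

lemma pm_add_in:
  "persistence_module M \<Longrightarrow> v \<in> pm_at M p \<Longrightarrow> w \<in> pm_at M p \<Longrightarrow> v + w \<in> pm_at M p"
  by (rule module.subspace_add[OF pm_module pm_subspace])

lemma pm_diff_in:
  "persistence_module M \<Longrightarrow> v \<in> pm_at M p \<Longrightarrow> w \<in> pm_at M p \<Longrightarrow> v - w \<in> pm_at M p"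
  by (rule module.subspace_diff[OF pm_module pm_subspace])

lemma pm_scale_in:
  "persistence_module M \<Longrightarrow> v \<in> pm_at M p \<Longrightarrow> pm_scale M c v \<in> pm_at M p"
  by (rule module.subspace_scale[OF pm_module pm_subspace])

lemma pm_map_linear:
  "persistence_module M \<Longrightarrow> p \<le> q \<Longrightarrow>
    linear_map_on (pm_scale M) (pm_scale M) (pm_at M p) (pm_at M q) (pm_map M p q)"
  by (simp add: persistence_module_def)

lemma pm_map_in:
  "persistence_module M \<Longrightarrow> p \<le> q \<Longrightarrow> v \<in> pm_at M p \<Longrightarrow> pm_map M p q v \<in> pm_at M q"
  using pm_map_linear unfolding linear_map_on_def by blast

lemma pm_map_add:
  "persistence_module M \<Longrightarrow> p \<le> q \<Longrightarrow> v \<in> pm_at M p \<Longrightarrow> w \<in> pm_at M p \<Longrightarrow>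
    pm_map M p q (v + w) = pm_map M p q v + pm_map M p q w"
  using pm_map_linear unfolding linear_map_on_def by blast

lemma pm_map_scale:
  "persistence_module M \<Longrightarrow> p \<le> q \<Longrightarrow> v \<in> pm_at M p \<Longrightarrow>
    pm_map M p q (pm_scale M c v) = pm_scale M c (pm_map M p q v)"
  using pm_map_linear unfolding linear_map_on_def by blast

lemma pm_map_id: "persistence_module M \<Longrightarrow> v \<in> pm_at M p \<Longrightarrow> pm_map M p p v = v"
  by (simp add: persistence_module_def)

lemma pm_map_comp:
  "persistence_module M \<Longrightarrow> p \<le> q \<Longrightarrow> q \<le> r \<Longrightarrow> v \<in> pm_at M p \<Longrightarrow>
    pm_map M q r (pm_map M p q v) = pm_map M p r v"
  by (simp add: persistence_module_def)

lemma pm_hom_source: "pm_hom M N f \<Longrightarrow> persistence_module M"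
  and pm_hom_target: "pm_hom M N f \<Longrightarrow> persistence_module N"
  by (auto simp: pm_hom_def)

lemma pm_hom_in: "pm_hom M N f \<Longrightarrow> v \<in> pm_at M p \<Longrightarrow> f p v \<in> pm_at N p"
  unfolding pm_hom_def linear_map_on_def by blast

lemma pm_hom_add:
  "pm_hom M N f \<Longrightarrow> v \<in> pm_at M p \<Longrightarrow> w \<in> pm_at M p \<Longrightarrow> f p (v + w) = f p v + f p w"
  unfolding pm_hom_def linear_map_on_def by blast

lemma pm_hom_scale:
  "pm_hom M N f \<Longrightarrow> v \<in> pm_at M p \<Longrightarrow> f p (pm_scale M c v) = pm_scale N c (f p v)"
  unfolding pm_hom_def linear_map_on_def by blast

lemma pm_hom_natural:
  "pm_hom M N f \<Longrightarrow> p \<le> q \<Longrightarrow> v \<in> pm_at M p \<Longrightarrow>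
    f q (pm_map M p q v) = pm_map N p q (f p v)"
  unfolding pm_hom_def by blast

lemma pm_hom_zero: "pm_hom M N f \<Longrightarrow> f p 0 = 0"
  using pm_hom_add[of M N f 0 p 0] pm_zero_in[OF pm_hom_source, of M N f p] by simp

lemma pm_hom_diff:
  assumes "pm_hom M N f" "v \<in> pm_at M p" "w \<in> pm_at M p"
  shows "f p (v - w) = f p v - f p w"
  using pm_hom_add[OF assms(1) pm_diff_in[OF pm_hom_source[OF assms(1)] assms(2,3)] assms(3)]
  by (simp add: algebra_simps)

lemma pm_homI:
  assumes "persistence_module M" "persistence_module N"
    and "\<And>p v. v \<in> pm_at M p \<Longrightarrow> f p v \<in> pm_at N p"
    and "\<And>p v w. v \<in> pm_at M p \<Longrightarrow> w \<in> pm_at M p \<Longrightarrow> f p (v + w) = f p v + f p w"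
    and "\<And>p c v. v \<in> pm_at M p \<Longrightarrow> f p (pm_scale M c v) = pm_scale N c (f p v)"
    and "\<And>p q v. p \<le> q \<Longrightarrow> v \<in> pm_at M p \<Longrightarrow>
      f q (pm_map M p q v) = pm_map N p q (f p v)"
  shows "pm_hom M N f"
  using assms unfolding pm_hom_def linear_map_on_def by blast

lemma pm_hom_comp:
  assumes f: "pm_hom M N f" and g: "pm_hom N L g"
  shows "pm_hom M L (\<lambda>p v. g p (f p v))"
  by (rule pm_homI[OF pm_hom_source[OF f] pm_hom_target[OF g]])
    (simp_all add: pm_hom_in[OF f] pm_hom_in[OF g] pm_hom_add[OF f] pm_hom_add[OF g]
      pm_hom_scale[OF f] pm_hom_scale[OF g] pm_hom_natural[OF f] pm_hom_natural[OF g])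

lemma pm_hom_scaled:
  assumes f: "pm_hom M N f"
  shows "pm_hom M N (\<lambda>p v. pm_scale N c (f p v))"
proof -
  note N = pm_hom_target[OF f]
  interpret vs: vector_space "pm_scale N" using N by (rule pm_vector_space)
  show ?thesis
    by (rule pm_homI[OF pm_hom_source[OF f] N])
      (simp_all add: pm_hom_in[OF f] pm_scale_in[OF N] pm_hom_add[OF f] vs.scale_right_distrib
        pm_hom_scale[OF f] pm_hom_natural[OF f] pm_map_scale[OF N] mult.commute)
qed

lemma pm_hom_complement:
  assumes e: "pm_hom M M e"
  shows "pm_hom M M (\<lambda>p v. v - e p v)"
proof -
  note M = pm_hom_source[OF e]
  interpret vs: vector_space "pm_scale M" using M by (rule pm_vector_space)
  have "pm_map M p q (v - w) = pm_map M p q v - pm_map M p q w"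
    if "p \<le> q" "v \<in> pm_at M p" "w \<in> pm_at M p" for p q v w
    using pm_map_add[OF M that(1) pm_diff_in[OF M that(2,3)] that(3)] by (simp add: algebra_simps)
  then show ?thesis
    by (intro pm_homI[OF M M])
      (simp_all add: pm_hom_in[OF e] pm_diff_in[OF M] pm_hom_add[OF e] vs.scale_right_diff_distrib
        pm_hom_scale[OF e] pm_hom_natural[OF e])
qed

text \<open>
  The axioms of a persistence module pass to a quotient: the maps of the target are forced by
  naturality, and spanning sets map to spanning sets.  Images, direct sums and interval modules
  are recognised below as persistence modules, in particular as finite-dimensional ones, by
  exhibiting a surjection onto them.
\<close>

lemma pm_hom_of_surjection:
  assumes M: "persistence_module M" and V: "vector_space (pm_scale N)"
    and surj: "\<And>p. f p ` pm_at M p = pm_at N p"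
    and add: "\<And>p v w. v \<in> pm_at M p \<Longrightarrow> w \<in> pm_at M p \<Longrightarrow> f p (v + w) = f p v + f p w"
    and scale: "\<And>p c v. v \<in> pm_at M p \<Longrightarrow> f p (pm_scale M c v) = pm_scale N c (f p v)"
    and nat: "\<And>p q v. p \<le> q \<Longrightarrow> v \<in> pm_at M p \<Longrightarrow>
      f q (pm_map M p q v) = pm_map N p q (f p v)"
  shows "pm_hom M N f"
proof -
  interpret M: vector_space "pm_scale M" using M by (rule pm_vector_space)
  interpret N: vector_space "pm_scale N" by (rule V)
  have f0: "f p 0 = 0" for p
    using add[of 0 p 0] pm_zero_in[OF M] by simp
  have image_subspace: "N.subspace (f p ` W)" if "M.subspace W" "W \<subseteq> pm_at M p" for p W
  proof (rule N.subspaceI)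
    show "0 \<in> f p ` W"
      using f0[of p] M.subspace_0[OF that(1)] by (metis imageI)
    show "x + y \<in> f p ` W" if xy: "x \<in> f p ` W" "y \<in> f p ` W" for x y
    proof -
      obtain a b where ab: "a \<in> W" "x = f p a" "b \<in> W" "y = f p b"
        using xy by blast
      then have "x + y = f p (a + b)" using \<open>W \<subseteq> pm_at M p\<close> by (auto simp: add subsetD)
      then show ?thesis using M.subspace_add[OF \<open>M.subspace W\<close> ab(1,3)] by blast
    qed
    show "pm_scale N c x \<in> f p ` W" if x: "x \<in> f p ` W" for c x
    proof -
      obtain a where a: "a \<in> W" "x = f p a"
        using x by blast
      then have "pm_scale N c x = f p (pm_scale M c a)"
        using \<open>W \<subseteq> pm_at M p\<close> by (auto simp: scale subsetD)
      then show ?thesis using M.subspace_scale[OF \<open>M.subspace W\<close> a(1)] by blast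
    qed
  qed
  have fin: "\<exists>B. finite B \<and> N.span B = pm_at N p" for p
  proof -
    obtain B where B: "finite B" "M.span B = pm_at M p"
      using pm_finite_dimensional[OF M] by blast
    have "M.span B \<subseteq> {v \<in> pm_at M p. f p v \<in> N.span (f p ` B)}"
    proof (rule M.span_minimal)
      show "B \<subseteq> {v \<in> pm_at M p. f p v \<in> N.span (f p ` B)}"
      proof
        fix x assume x: "x \<in> B"
        show "x \<in> {v \<in> pm_at M p. f p v \<in> N.span (f p ` B)}"
          using M.span_base[OF x] N.span_base[OF imageI[OF x]] unfolding B(2) by blast
      qed
      show "M.subspace {v \<in> pm_at M p. f p v \<in> N.span (f p ` B)}"
        by (rule M.subspaceI)
          (auto simp: pm_zero_in[OF M] pm_add_in[OF M] pm_scale_in[OF M] f0 add scale N.span_zero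
            N.span_add N.span_scale)
    qed
    moreover have "N.span (f p ` B) \<subseteq> f p ` M.span B"
      by (rule N.span_minimal)
        (auto intro!: image_subspace simp: B(2) M.span_base[of _ B, unfolded B(2)] pm_subspace[OF M])
    ultimately have "N.span (f p ` B) = pm_at N p"
      unfolding B(2) surj by (auto simp: surj[symmetric])
    then show ?thesis using B(1) by (intro exI[of _ "f p ` B"]) simp
  qed
  have obt: "\<exists>v \<in> pm_at M p. w = f p v" if "w \<in> pm_at N p" for p w
    using that surj[of p] by blast
  have f_in: "f p v \<in> pm_at N p" if "v \<in> pm_at M p" for p v
    using that surj[of p] by blast
  have lin: "linear_map_on (pm_scale N) (pm_scale N) (pm_at N p) (pm_at N q) (pm_map N p q)"
    if pq: "p \<le> q" for p q
    unfolding linear_map_on_def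
  proof (intro conjI ballI allI subsetI)
    show "w \<in> pm_at N q" if w: "w \<in> pm_map N p q ` pm_at N p" for w
    proof -
      obtain v a where "a \<in> pm_at M p" "v = f p a" "w = pm_map N p q v"
        using w obt by blast
      then have "w = f q (pm_map M p q a)" "pm_map M p q a \<in> pm_at M q"
        using nat[OF pq] pm_map_in[OF M pq] by auto
      then show ?thesis using f_in by blast
    qed
    show "pm_map N p q (v + w) = pm_map N p q v + pm_map N p q w"
      if vw: "v \<in> pm_at N p" "w \<in> pm_at N p" for v w
    proof -
      obtain a b where ab: "a \<in> pm_at M p" "v = f p a" "b \<in> pm_at M p" "w = f p b"
        using vw obt by blast
      show ?thesis
        using ab nat[OF pq, symmetric]
        by (simp add: add[symmetric] pm_add_in[OF M] pm_map_add[OF M pq] pm_map_in[OF M pq])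
    qed
    show "pm_map N p q (pm_scale N c v) = pm_scale N c (pm_map N p q v)"
      if v: "v \<in> pm_at N p" for c v
    proof -
      obtain a where a: "a \<in> pm_at M p" "v = f p a"
        using v obt by blast
      show ?thesis
        using a nat[OF pq, symmetric]
        by (simp add: scale[symmetric] pm_scale_in[OF M] pm_map_scale[OF M pq] pm_map_in[OF M pq])
    qed
  qed
  have "persistence_module N"
    unfolding persistence_module_def
  proof (intro conjI allI impI ballI)
    show "N.subspace (pm_at N p)" for p
      using image_subspace[OF pm_subspace[OF M] subset_refl, of p] surj by simp
    show "pm_map N p p v = v" if "v \<in> pm_at N p" for p v
      using obt[OF that] nat[of p p] pm_map_id[OF M] by fastforce
    show "pm_map N q r (pm_map N p q v) = pm_map N p r v"
      if "p \<le> q" "q \<le> r" "v \<in> pm_at N p" for p q r v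
    proof -
      obtain a where a: "a \<in> pm_at M p" "v = f p a"
        using \<open>v \<in> pm_at N p\<close> obt by blast
      show ?thesis
        using a nat[OF \<open>p \<le> q\<close>, of a] nat[OF \<open>q \<le> r\<close>, of "pm_map M p q a"]
          nat[OF order_trans[OF \<open>p \<le> q\<close> \<open>q \<le> r\<close>], of a] pm_map_in[OF M \<open>p \<le> q\<close> a(1)]
          pm_map_comp[OF M \<open>p \<le> q\<close> \<open>q \<le> r\<close> a(1)] by simp
    qed
  qed (use V fin lin in auto)
  then show ?thesis
    using pm_homI[OF M _ f_in add scale nat] by blast
qed

lemma pm_iso_hom: "pm_iso M N f \<Longrightarrow> pm_hom M N f"
  by (simp add: pm_iso_def)

lemma pm_iso_bij: "pm_iso M N f \<Longrightarrow> bij_betw (f p) (pm_at M p) (pm_at N p)"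
  by (simp add: pm_iso_def)

lemma pm_isoI_inverse:
  assumes f: "pm_hom M N f" and g: "pm_hom N M g"
    and "\<And>p v. v \<in> pm_at M p \<Longrightarrow> g p (f p v) = v"
    and "\<And>p w. w \<in> pm_at N p \<Longrightarrow> f p (g p w) = w"
  shows "pm_iso M N f"
  unfolding pm_iso_def using assms pm_hom_in[OF f] pm_hom_in[OF g]
  by (auto intro!: bij_betw_byWitness[where f' = "g _"])

lemma pm_iso_inverse:
  assumes f: "pm_iso M N f"
  obtains g where "pm_hom N M g"
    and "\<And>p v. v \<in> pm_at M p \<Longrightarrow> g p (f p v) = v"
    and "\<And>p w. w \<in> pm_at N p \<Longrightarrow> f p (g p w) = w"
proof -
  define g where "g p = inv_into (pm_at M p) (f p)" for p
  note hom = pm_iso_hom[OF f] and bij = pm_iso_bij[OF f]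
  have M: "persistence_module M" and N: "persistence_module N"
    using hom by (auto simp: pm_hom_def)
  have gf: "g p (f p v) = v" if "v \<in> pm_at M p" for p v
    using bij_betw_inv_into_left[OF bij that] by (simp add: g_def)
  have fg: "f p (g p w) = w" if "w \<in> pm_at N p" for p w
    using bij_betw_inv_into_right[OF bij that] by (simp add: g_def)
  have surj: "g p ` pm_at N p = pm_at M p" for p
    using bij_betw_imp_surj_on[OF bij_betw_inv_into[OF bij]] by (simp add: g_def[abs_def])
  then have g_in: "g p w \<in> pm_at M p" if "w \<in> pm_at N p" for p w
    using that by blast
  have "pm_hom N M g"
  proof (rule pm_homI[OF N M g_in])
    show "g p (v + w) = g p v + g p w" if "v \<in> pm_at N p" "w \<in> pm_at N p" for p v w
      using gf[of "g p v + g p w" p] that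
      by (simp add: pm_hom_add[OF hom] g_in fg pm_add_in[OF M])
    show "g p (pm_scale N c v) = pm_scale M c (g p v)" if "v \<in> pm_at N p" for p c v
      using gf[of "pm_scale M c (g p v)" p] that
      by (simp add: pm_hom_scale[OF hom] g_in fg pm_scale_in[OF M])
    show "g q (pm_map N p q v) = pm_map M p q (g p v)" if "p \<le> q" "v \<in> pm_at N p" for p q v
      using gf[of "pm_map M p q (g p v)" q] that
      by (simp add: pm_hom_natural[OF hom] g_in fg pm_map_in[OF M])
  qed
  then show thesis using gf fg that by blast
qed

lemma pm_isomorphic_sym: "M \<cong>\<^sub>p\<^sub>m N \<Longrightarrow> N \<cong>\<^sub>p\<^sub>m M"
  unfolding pm_isomorphic_def
  by (metis pm_iso_hom pm_iso_inverse pm_isoI_inverse)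

section \<open>Splitting idempotents\<close>

lemma pm_image_hom:
  assumes f: "pm_hom M N f"
  shows "pm_hom M (pm_image f M N) f"
  by (rule pm_hom_of_surjection[OF pm_hom_source[OF f]])
    (simp_all add: pm_image_def pm_vector_space[OF pm_hom_target[OF f]] pm_hom_add[OF f]
      pm_hom_scale[OF f] pm_hom_natural[OF f])

lemma pm_image_submodule:
  assumes f: "pm_hom M N f"
  shows "pm_submodule (pm_image f M N) N"
  using pm_hom_target[OF pm_image_hom[OF f]] pm_hom_target[OF f] pm_hom_in[OF f]
  by (auto simp: pm_submodule_def pm_image_def)

lemma pm_submodule_inclusion: "pm_submodule N M \<Longrightarrow> pm_hom N M (\<lambda>p v. v)"
  by (auto simp: pm_submodule_def intro!: pm_homI)

lemma pm_sum_simps: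
  "pm_scale (M \<oplus>\<^sub>p\<^sub>m N) c (v, w) = (pm_scale M c v, pm_scale N c w)"
  "pm_at (M \<oplus>\<^sub>p\<^sub>m N) p = pm_at M p \<times> pm_at N p"
  "pm_map (M \<oplus>\<^sub>p\<^sub>m N) p q (v, w) = (pm_map M p q v, pm_map N p q w)"
  by (simp_all add: pm_sum_def)

lemma vector_space_pm_sum:
  assumes "vector_space (pm_scale M)" "vector_space (pm_scale N)"
  shows "vector_space (pm_scale (M \<oplus>\<^sub>p\<^sub>m N))"
  using assms by (auto simp: vector_space_def pm_sum_def)

text \<open>
  If \<open>e\<close> is idempotent, then so is \<open>1 - e\<close>, and every vector \<open>v\<close> is in a unique way the sum of
  a vector \<open>v - e v\<close> fixed by \<open>1 - e\<close> and a vector \<open>e v\<close> fixed by \<open>e\<close>.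
\<close>

lemma idempotent_splits:
  assumes e: "pm_hom M M e" and idem: "\<And>p v. v \<in> pm_at M p \<Longrightarrow> e p (e p v) = e p v"
  defines "N \<equiv> pm_image (\<lambda>p v. v - e p v) M M" and "C \<equiv> pm_image e M M"
  shows "pm_iso M (N \<oplus>\<^sub>p\<^sub>m C) (\<lambda>p v. (v - e p v, e p v))"
    and "pm_iso (N \<oplus>\<^sub>p\<^sub>m C) M (\<lambda>p (v, w). v + w)"
proof -
  note M = pm_hom_source[OF e] and e' = pm_hom_complement[OF e]
  interpret vs: vector_space "pm_scale M" using M by (rule pm_vector_space)
  have e_fix: "e p (v - e p v) = 0" if "v \<in> pm_at M p" for p v
    using that by (simp add: pm_hom_diff[OF e] pm_hom_in[OF e] idem)
  have hom: "pm_hom M (N \<oplus>\<^sub>p\<^sub>m C) (\<lambda>p v. (v - e p v, e p v))"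
  proof (rule pm_hom_of_surjection[OF M])
    show "vector_space (pm_scale (N \<oplus>\<^sub>p\<^sub>m C))"
      by (rule vector_space_pm_sum) (simp_all add: N_def C_def pm_image_def pm_vector_space[OF M])
    show "(\<lambda>v. (v - e p v, e p v)) ` pm_at M p = pm_at (N \<oplus>\<^sub>p\<^sub>m C) p" for p
    proof
      show "pm_at (N \<oplus>\<^sub>p\<^sub>m C) p \<subseteq> (\<lambda>v. (v - e p v, e p v)) ` pm_at M p"
      proof
        fix z assume "z \<in> pm_at (N \<oplus>\<^sub>p\<^sub>m C) p"
        then obtain v w where vw: "v \<in> pm_at M p" "w \<in> pm_at M p" "z = (v - e p v, e p w)"
          by (auto simp: pm_sum_simps N_def C_def pm_image_def)
        have "e p (v - e p v + e p w) = e p w"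
          using vw by (simp add: pm_hom_add[OF e] pm_diff_in[OF M] pm_hom_in[OF e] e_fix idem)
        moreover have "v - e p v + e p w \<in> pm_at M p"
          using vw by (simp add: pm_add_in[OF M] pm_diff_in[OF M] pm_hom_in[OF e])
        ultimately show "z \<in> (\<lambda>v. (v - e p v, e p v)) ` pm_at M p"
          using vw(3) by (intro image_eqI[of _ _ "v - e p v + e p w"]) auto
      qed
    qed (auto simp: pm_sum_simps N_def C_def pm_image_def)
  qed (simp_all add: pm_sum_simps N_def C_def pm_image_def pm_hom_add[OF e'] vs.scale_right_diff_distrib
      pm_hom_add[OF e] pm_hom_scale[OF e] pm_hom_natural[OF e', symmetric]
      pm_hom_natural[OF e, symmetric])
  have hom': "pm_hom (N \<oplus>\<^sub>p\<^sub>m C) M (\<lambda>p (v, w). v + w)"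
  proof (rule pm_homI[OF pm_hom_target[OF hom] M])
    have mem: "v \<in> pm_at M p \<and> w \<in> pm_at M p" if "(v, w) \<in> pm_at (N \<oplus>\<^sub>p\<^sub>m C) p" for v w p
      using that pm_hom_in[OF e] pm_hom_in[OF e'] by (auto simp: pm_sum_simps N_def C_def pm_image_def)
    show "(case z of (v, w) \<Rightarrow> v + w) \<in> pm_at M p" if "z \<in> pm_at (N \<oplus>\<^sub>p\<^sub>m C) p" for p z
      using that mem pm_add_in[OF M] by (cases z) auto
    show "(case pm_map (N \<oplus>\<^sub>p\<^sub>m C) p q z of (v, w) \<Rightarrow> v + w) =
        pm_map M p q (case z of (v, w) \<Rightarrow> v + w)"
      if "p \<le> q" "z \<in> pm_at (N \<oplus>\<^sub>p\<^sub>m C) p" for p q z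
    proof (cases z)
      case (Pair v w)
      then show ?thesis
        using that mem[of v w p] by (simp add: pm_sum_simps N_def C_def pm_image_def pm_map_add[OF M])
    qed
    show "(case pm_scale (N \<oplus>\<^sub>p\<^sub>m C) c z of (v, w) \<Rightarrow> v + w) =
        pm_scale M c (case z of (v, w) \<Rightarrow> v + w)"
      for c z
      by (cases z) (simp add: pm_sum_simps N_def C_def pm_image_def vs.scale_right_distrib)
  qed auto
  have inv: "(\<lambda>v. (v - e p v, e p v)) (case z of (v, w) \<Rightarrow> v + w) = z"
    if z: "z \<in> pm_at (N \<oplus>\<^sub>p\<^sub>m C) p" for p z
  proof -
    obtain v w where vw: "v \<in> pm_at M p" "w \<in> pm_at M p" "z = (v - e p v, e p w)"
      using z by (auto simp: pm_sum_simps N_def C_def pm_image_def)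
    then show ?thesis
      by (simp add: pm_hom_add[OF e] pm_diff_in[OF M] pm_hom_in[OF e] e_fix idem)
  qed
  show "pm_iso M (N \<oplus>\<^sub>p\<^sub>m C) (\<lambda>p v. (v - e p v, e p v))"
    by (rule pm_isoI_inverse[OF hom hom']) (use inv in auto)
  show "pm_iso (N \<oplus>\<^sub>p\<^sub>m C) M (\<lambda>p (v, w). v + w)"
    by (rule pm_isoI_inverse[OF hom' hom]) (use inv in auto)
qed

lemma idempotent_direct_summand:
  assumes e: "pm_hom M M e" and idem: "\<And>p v. v \<in> pm_at M p \<Longrightarrow> e p (e p v) = e p v"
  shows "pm_direct_summand (pm_image (\<lambda>p v. v - e p v) M M) M"
  using idempotent_splits(2)[OF e idem] pm_image_submodule[OF e]
    pm_image_submodule[OF pm_hom_complement[OF e]]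
  unfolding pm_direct_summand_def by blast

text \<open>
  A retract of an indecomposable module is zero or the whole module: \<open>a \<circ> b\<close> is an idempotent
  of \<open>G\<close> with image isomorphic to \<open>N\<close>, so indecomposability makes it zero or the identity.
\<close>

lemma retract_of_indecomposable:
  assumes G: "pm_indecomposable G" and a: "pm_hom N G a" and b: "pm_hom G N b"
    and ba: "\<And>p v. v \<in> pm_at N p \<Longrightarrow> b p (a p v) = v" and nz: "\<not> pm_zero N"
  shows "pm_iso N G a"
proof -
  define e where "e p v = a p (b p v)" for p v
  have e: "pm_hom G G e"
    unfolding e_def[abs_def] by (rule pm_hom_comp[OF b a])
  have idem: "e p (e p v) = e p v" if "v \<in> pm_at G p" for p v
    using that by (simp add: e_def ba pm_hom_in[OF b])
  note e' = pm_hom_complement[OF e]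
  have "pm_zero (pm_image (\<lambda>p v. v - e p v) G G) \<or> pm_zero (pm_image e G G)"
    using G idempotent_splits(1)[OF e idem] pm_hom_target[OF pm_image_hom[OF e]]
      pm_hom_target[OF pm_image_hom[OF e']]
    unfolding pm_indecomposable_def pm_isomorphic_def by blast
  moreover have "\<not> pm_zero (pm_image e G G)"
  proof
    assume z: "pm_zero (pm_image e G G)"
    have "v = 0" if v: "v \<in> pm_at N p" for p v
    proof -
      have "e p (a p v) = 0"
        using z pm_hom_in[OF a v] by (auto simp: pm_zero_def pm_image_def)
      then have "a p v = 0" by (simp add: e_def ba v)
      then show ?thesis using ba[OF v] pm_hom_zero[OF b] by simp
    qed
    then have "pm_zero N"
      using pm_zero_in[OF pm_hom_source[OF a]] by (auto simp: pm_zero_def)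
    with nz show False ..
  qed
  ultimately have "pm_zero (pm_image (\<lambda>p v. v - e p v) G G)"
    by blast
  then have "v - e p v = 0" if "v \<in> pm_at G p" for p v
    using that imageI[OF that, of "\<lambda>v. v - e p v"] by (auto simp: pm_zero_def pm_image_def)
  then show ?thesis
    by (intro pm_isoI_inverse[OF a b ba]) (auto simp: e_def)
qed

section \<open>Cyclic modules\<close>

text \<open>
  The module split off by a rooted generator has a single generator \<open>v\<close>, in the degree \<open>p\<close> of the
  rooted generator.  Its spaces are therefore lines or zero, and a morphism out of it is
  determined by one value; in particular its endomorphisms are scalars.
\<close>

definition pm_cyclic ::
  "('p::{finite,order}, 'k::field, 'v::ab_group_add) pmod \<Rightarrow> 'p \<Rightarrow> 'v \<Rightarrow> bool" where
  "pm_cyclic M p v \<longleftrightarrow>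
     persistence_module M \<and> v \<in> pm_at M p \<and> v \<noteq> 0 \<and>
     (\<forall>q. pm_at M q = (if p \<le> q then range (\<lambda>c. pm_scale M c (pm_map M p q v)) else {0}))"

lemma pm_cyclic_nonzero: "pm_cyclic M p v \<Longrightarrow> \<not> pm_zero M"
  unfolding pm_cyclic_def pm_zero_def by blast

lemma pm_cyclic_module: "pm_cyclic M p v \<Longrightarrow> persistence_module M"
  by (simp add: pm_cyclic_def)

lemma pm_cyclic_generates:
  "pm_cyclic M p v \<Longrightarrow> p \<le> q \<Longrightarrow> w \<in> pm_at M q \<Longrightarrow> \<exists>c. w = pm_scale M c (pm_map M p q v)"
  by (auto simp: pm_cyclic_def)

lemma pm_cyclic_vanishes:
  "pm_cyclic M p v \<Longrightarrow> \<not> p \<le> q \<Longrightarrow> w \<in> pm_at M q \<Longrightarrow> w = 0"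
  by (auto simp: pm_cyclic_def)

lemma pm_cyclic_hom_ext:
  assumes M: "pm_cyclic M p v" and f: "pm_hom M N f" and g: "pm_hom M N g"
    and eq: "f p v = g p v" and w: "w \<in> pm_at M q"
  shows "f q w = g q w"
proof (cases "p \<le> q")
  case True
  then obtain c where c: "w = pm_scale M c (pm_map M p q v)"
    using pm_cyclic_generates[OF M _ w] by blast
  have v: "v \<in> pm_at M p" using M unfolding pm_cyclic_def by blast
  note v' = pm_map_in[OF pm_cyclic_module[OF M] True v]
  show ?thesis
    using eq by (simp add: c pm_hom_scale[OF f v'] pm_hom_scale[OF g v']
        pm_hom_natural[OF f True v] pm_hom_natural[OF g True v])
next
  case False
  then have "w = 0" by (rule pm_cyclic_vanishes[OF M _ w])
  then show ?thesis by (simp add: pm_hom_zero[OF f] pm_hom_zero[OF g])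
qed

lemma pm_cyclic_iso:
  assumes M: "pm_cyclic M p v" and f: "pm_iso M N f"
  shows "pm_cyclic N p (f p v)"
proof -
  note hom = pm_iso_hom[OF f] and bij = pm_iso_bij[OF f]
  have v: "v \<in> pm_at M p" "v \<noteq> 0" using M unfolding pm_cyclic_def by blast+
  have "f p v \<noteq> 0"
    using v bij_betw_imp_inj_on[OF bij] pm_hom_zero[OF hom] pm_zero_in[OF pm_hom_source[OF hom]]
    by (metis inj_onD)
  moreover have "pm_at N q = (if p \<le> q then range (\<lambda>c. pm_scale N c (pm_map N p q (f p v))) else {0})"
    for q
  proof -
    have "pm_at N q = f q ` pm_at M q"
      using bij_betw_imp_surj_on[OF bij] by blast
    also have "pm_at M q = (if p \<le> q then range (\<lambda>c. pm_scale M c (pm_map M p q v)) else {0})"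
      using M by (simp add: pm_cyclic_def)
    finally show ?thesis
      using pm_hom_scale[OF hom pm_map_in[OF pm_hom_source[OF hom] _ v(1), of q]]
        pm_hom_natural[OF hom _ v(1), of q] pm_hom_zero[OF hom]
      by (auto simp: image_image)
  qed
  ultimately show ?thesis
    using pm_hom_in[OF hom v(1)] pm_hom_target[OF hom] unfolding pm_cyclic_def by blast
qed

text \<open>
  In a direct sum \<open>F1 \<oplus> F2\<close> generated by \<open>(a, b)\<close>, the space at the degree of the generator is a
  line that contains \<open>(a, 0)\<close> and \<open>(0, b)\<close>.  Hence \<open>a = 0\<close> or \<open>b = 0\<close>, and the corresponding
  summand vanishes in all degrees.
\<close>

lemma pm_cyclic_indecomposable:
  fixes M :: "('p::{finite,order}, 'k::field, 'v::ab_group_add) pmod"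
  assumes M: "pm_cyclic M p v"
  shows "pm_indecomposable M"
  unfolding pm_indecomposable_def
proof (intro conjI allI impI)
  show "persistence_module M" using M by (rule pm_cyclic_module)
  fix F1 F2 :: "('p, 'k, 'v) pmod"
  assume F1: "persistence_module F1" and F2: "persistence_module F2" and "M \<cong>\<^sub>p\<^sub>m F1 \<oplus>\<^sub>p\<^sub>m F2"
  then obtain a b where ab: "pm_cyclic (F1 \<oplus>\<^sub>p\<^sub>m F2) p (a, b)"
    using pm_cyclic_iso[OF M] unfolding pm_isomorphic_def by (metis surj_pair)
  interpret V1: vector_space "pm_scale F1" using F1 by (rule pm_vector_space)
  interpret V2: vector_space "pm_scale F2" using F2 by (rule pm_vector_space)
  have in_ab: "a \<in> pm_at F1 p" "b \<in> pm_at F2 p"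
    using ab by (auto simp: pm_cyclic_def pm_sum_simps)
  have gen: "\<exists>c. x = pm_scale F1 c (pm_map F1 p q a) \<and> y = pm_scale F2 c (pm_map F2 p q b)"
    if "p \<le> q" "x \<in> pm_at F1 q" "y \<in> pm_at F2 q" for q x y
  proof -
    have "(x, y) \<in> pm_at (F1 \<oplus>\<^sub>p\<^sub>m F2) q" using that by (simp add: pm_sum_simps)
    from pm_cyclic_generates[OF ab that(1) this] show ?thesis by (simp add: pm_sum_simps)
  qed
  have zero: "x = 0 \<and> y = 0" if "\<not> p \<le> q" "x \<in> pm_at F1 q" "y \<in> pm_at F2 q" for q x y
  proof -
    have "(x, y) \<in> pm_at (F1 \<oplus>\<^sub>p\<^sub>m F2) q" using that by (simp add: pm_sum_simps)
    from pm_cyclic_vanishes[OF ab that(1) this] show ?thesis by (simp add: zero_prod_def)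
  qed
  have "a = 0 \<or> b = 0"
    using gen[of p a 0] in_ab pm_zero_in[OF F2] pm_map_id[OF F1] pm_map_id[OF F2] by fastforce
  then show "pm_zero F1 \<or> pm_zero F2"
  proof
    assume "a = 0"
    have "x = 0" if x: "x \<in> pm_at F1 q" for q x
    proof (cases "p \<le> q")
      case True
      have "pm_map F1 p q 0 = 0"
        using pm_map_add[OF F1 True pm_zero_in[OF F1] pm_zero_in[OF F1]] by simp
      then show ?thesis using gen[OF True x pm_zero_in[OF F2]] \<open>a = 0\<close> by auto
    qed (use zero x pm_zero_in[OF F2] in blast)
    then show ?thesis using pm_zero_in[OF F1] by (auto simp: pm_zero_def)
  next
    assume "b = 0"
    have "x = 0" if x: "x \<in> pm_at F2 q" for q x
    proof (cases "p \<le> q")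
      case True
      have "pm_map F2 p q 0 = 0"
        using pm_map_add[OF F2 True pm_zero_in[OF F2] pm_zero_in[OF F2]] by simp
      then show ?thesis using gen[OF True pm_zero_in[OF F1] x] \<open>b = 0\<close> by auto
    qed (use zero x pm_zero_in[OF F1] in blast)
    then show ?thesis using pm_zero_in[OF F2] by (auto simp: pm_zero_def)
  qed
qed

text \<open>
  The support \<open>I\<close> consists of the degrees above \<open>p\<close> that the generator reaches without being
  mapped to zero.  It is connected because \<open>p\<close> is its least element, and convex because a vector
  that has died stays dead.
\<close>

lemma pm_cyclic_interval_module:
  fixes M :: "('p::{finite,order}, 'k::field, 'v::ab_group_add) pmod"
  assumes M: "pm_cyclic M p v"
  shows "\<exists>I. interval_subposet I \<and> M \<cong>\<^sub>p\<^sub>m (interval_module I :: ('p, 'k, 'k) pmod)"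
proof -
  note PM = pm_cyclic_module[OF M]
  interpret V: vector_space "pm_scale M" using PM by (rule pm_vector_space)
  have v: "v \<in> pm_at M p" "v \<noteq> 0" using M unfolding pm_cyclic_def by blast+
  define u where "u q = pm_map M p q v" for q
  define I where "I = {q. p \<le> q \<and> u q \<noteq> 0}"
  have u_map: "pm_map M q r (pm_scale M c (u q)) = pm_scale M c (u r)" if "p \<le> q" "q \<le> r" for q r c
    using that pm_map_in[OF PM that(1) v(1)]
    by (simp add: u_def pm_map_scale[OF PM] pm_map_comp[OF PM _ _ v(1)])
  have M_at: "pm_at M q = (if q \<in> I then range (\<lambda>c. pm_scale M c (u q)) else {0})" for q
    using M by (auto simp: pm_cyclic_def I_def u_def)
  have pI: "p \<in> I"
    using v by (simp add: I_def u_def pm_map_id[OF PM])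
  have up: "l \<in> I" if "i \<in> I" "i \<le> l" "l \<le> j" "j \<in> I" for i l j
  proof -
    have "p \<le> l" using that by (auto simp: I_def)
    moreover have "u l \<noteq> 0"
      using u_map[OF \<open>p \<le> l\<close> \<open>l \<le> j\<close>, of 0] u_map[OF \<open>p \<le> l\<close> \<open>l \<le> j\<close>, of 1] that(4)
      by (auto simp: I_def)
    ultimately show ?thesis by (simp add: I_def)
  qed
  have interval: "interval_subposet I"
    unfolding interval_subposet_def
  proof (intro conjI ballI allI impI)
    let ?R = "{(a, b). a \<in> I \<and> b \<in> I \<and> (a \<le> b \<or> b \<le> a)}"
    show "(i, j) \<in> ?R\<^sup>*" if "i \<in> I" "j \<in> I" for i j
    proof (rule rtrancl_trans)
      show "(i, p) \<in> ?R\<^sup>*" "(p, j) \<in> ?R\<^sup>*"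
        using that pI by (auto simp: I_def)
    qed
  qed (use pI up in blast)+
  define f where "f q w = (if q \<in> I then THE c. w = pm_scale M c (u q) else 0)" for q w
  have f_eq: "f q (pm_scale M c (u q)) = c" if "q \<in> I" for q c
    using that by (auto simp: f_def I_def)
  have f0: "f q 0 = 0" for q
    using f_eq[of q 0] by (cases "q \<in> I") (auto simp: f_def)
  have hom: "pm_hom M (interval_module I :: ('p, 'k, 'k) pmod) f"
  proof (rule pm_hom_of_surjection[OF PM])
    show "vector_space (pm_scale (interval_module I :: ('p, 'k, 'k) pmod))"
      by (auto simp: interval_module_def vector_space_def algebra_simps)
    show "f q ` pm_at M q = pm_at (interval_module I :: ('p, 'k, 'k) pmod) q" for q
      by (auto simp: M_at interval_module_def f_eq f0 image_image)
    show "f q (w + z) = f q w + f q z" if "w \<in> pm_at M q" "z \<in> pm_at M q" for q w z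
      using that by (auto simp: M_at f_eq f0 V.scale_left_distrib[symmetric] split: if_splits)
    show "f q (pm_scale M c w) = pm_scale (interval_module I :: ('p, 'k, 'k) pmod) c (f q w)"
      if "w \<in> pm_at M q" for q c w
      using that by (auto simp: M_at f_eq f0 interval_module_def split: if_splits)
    show "f r (pm_map M q r w) = pm_map (interval_module I :: ('p, 'k, 'k) pmod) q r (f q w)"
      if qr: "q \<le> r" and w: "w \<in> pm_at M q" for q r w
    proof (cases "q \<in> I")
      case True
      then obtain c where "w = pm_scale M c (u q)" using w by (auto simp: M_at)
      then show ?thesis
        using True qr u_map[of q r c]
        by (auto simp: interval_module_def f_eq I_def f_def)
    next
      case False
      then have "w = 0" using w by (auto simp: M_at)
      moreover have "pm_map M q r 0 = 0"
        using pm_map_add[OF PM qr pm_zero_in[OF PM] pm_zero_in[OF PM]] by simp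
      ultimately show ?thesis by (simp add: interval_module_def f0)
    qed
  qed
  moreover have "bij_betw (f q) (pm_at M q) (pm_at (interval_module I :: ('p, 'k, 'k) pmod) q)" for q
    by (rule bij_betw_byWitness[where f' = "\<lambda>c. pm_scale M c (u q)"])
      (auto simp: M_at interval_module_def f_eq f0)
  ultimately show ?thesis
    using interval unfolding pm_isomorphic_def pm_iso_def by blast
qed

section \<open>Biproducts and cancellation\<close>

definition pm_biproduct ::
  "('p::{finite,order}, 'k::field, 'u::ab_group_add) pmod \<Rightarrow>
   ('p, 'k, 'v::ab_group_add) pmod \<Rightarrow> ('p, 'k, 'w::ab_group_add) pmod \<Rightarrow>
   ('p \<Rightarrow> 'v \<Rightarrow> 'u) \<Rightarrow> ('p \<Rightarrow> 'u \<Rightarrow> 'v) \<Rightarrow> ('p \<Rightarrow> 'w \<Rightarrow> 'u) \<Rightarrow> ('p \<Rightarrow> 'u \<Rightarrow> 'w) \<Rightarrow> bool" where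
  "pm_biproduct M N C i a j b \<longleftrightarrow>
     pm_hom N M i \<and> pm_hom M N a \<and> pm_hom C M j \<and> pm_hom M C b \<and>
     (\<forall>p. \<forall>v \<in> pm_at N p. a p (i p v) = v) \<and>
     (\<forall>p. \<forall>w \<in> pm_at C p. b p (j p w) = w) \<and>
     (\<forall>p. \<forall>u \<in> pm_at M p. i p (a p u) + j p (b p u) = u)"

lemma pm_biproductD:
  assumes "pm_biproduct M N C i a j b"
  shows "pm_hom N M i" "pm_hom M N a" "pm_hom C M j" "pm_hom M C b"
    and "\<And>p v. v \<in> pm_at N p \<Longrightarrow> a p (i p v) = v"
    and "\<And>p w. w \<in> pm_at C p \<Longrightarrow> b p (j p w) = w"
    and "\<And>p u. u \<in> pm_at M p \<Longrightarrow> i p (a p u) + j p (b p u) = u"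
  using assms by (simp_all add: pm_biproduct_def)

text \<open>
  Decomposing the vector \<open>j w\<close> as \<open>i (a (j w)) + j (b (j w))\<close> gives \<open>i (a (j w)) = 0\<close>, and \<open>i\<close> is
  injective.
\<close>

lemma pm_biproduct_orthogonal:
  assumes bp: "pm_biproduct M N C i a j b"
  shows "w \<in> pm_at C p \<Longrightarrow> a p (j p w) = 0"
    and "v \<in> pm_at N p \<Longrightarrow> b p (i p v) = 0"
proof -
  note D = pm_biproductD[OF bp]
  show "a p (j p w) = 0" if w: "w \<in> pm_at C p"
  proof -
    have "i p (a p (j p w)) = 0"
      using D(7)[OF pm_hom_in[OF D(3) w]] D(6)[OF w] by simp
    then show ?thesis
      using D(5)[OF pm_hom_in[OF D(2) pm_hom_in[OF D(3) w]]] pm_hom_zero[OF D(2)] by simp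
  qed
  show "b p (i p v) = 0" if v: "v \<in> pm_at N p"
  proof -
    have "j p (b p (i p v)) = 0"
      using D(7)[OF pm_hom_in[OF D(1) v]] D(5)[OF v] by simp
    then show ?thesis
      using D(6)[OF pm_hom_in[OF D(4) pm_hom_in[OF D(1) v]]] pm_hom_zero[OF D(4)] by simp
  qed
qed

lemma pm_biproduct_transport:
  assumes bp: "pm_biproduct L G D i a j b" and h: "pm_hom M L h" and h': "pm_hom L M h'"
    and h'h: "\<And>p v. v \<in> pm_at M p \<Longrightarrow> h' p (h p v) = v"
    and hh': "\<And>p w. w \<in> pm_at L p \<Longrightarrow> h p (h' p w) = w"
  shows "pm_biproduct M G D (\<lambda>p v. h' p (i p v)) (\<lambda>p u. a p (h p u))
    (\<lambda>p w. h' p (j p w)) (\<lambda>p u. b p (h p u))"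
  unfolding pm_biproduct_def
proof (intro conjI allI ballI)
  note D = pm_biproductD[OF bp]
  show "pm_hom G M (\<lambda>p v. h' p (i p v))" by (rule pm_hom_comp[OF D(1) h'])
  show "pm_hom M G (\<lambda>p u. a p (h p u))" by (rule pm_hom_comp[OF h D(2)])
  show "pm_hom D M (\<lambda>p w. h' p (j p w))" by (rule pm_hom_comp[OF D(3) h'])
  show "pm_hom M D (\<lambda>p u. b p (h p u))" by (rule pm_hom_comp[OF h D(4)])
  show "a p (h p (h' p (i p v))) = v" if "v \<in> pm_at G p" for p v
    using that by (simp add: hh' D(5) pm_hom_in[OF D(1)])
  show "b p (h p (h' p (j p w))) = w" if "w \<in> pm_at D p" for p w
    using that by (simp add: hh' D(6) pm_hom_in[OF D(3)])
  show "h' p (i p (a p (h p u))) + h' p (j p (b p (h p u))) = u" if "u \<in> pm_at M p" for p u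
    using that D(7)[OF pm_hom_in[OF h that]] h'h
      pm_hom_add[OF h' pm_hom_in[OF D(1) pm_hom_in[OF D(2)]] pm_hom_in[OF D(3) pm_hom_in[OF D(4)]],
        OF pm_hom_in[OF h that] pm_hom_in[OF h that]]
    by simp
qed

text \<open>
  If \<open>N\<close>, viewed inside \<open>M\<close>, projects isomorphically to \<open>G\<close> along \<open>D\<close>, then \<open>N\<close> meets \<open>D\<close>
  trivially and spans \<open>M\<close> together with it.  So \<open>C\<close> and \<open>D\<close> are both complements of \<open>N\<close>,
  and the projection along \<open>N\<close> identifies them.
\<close>

lemma pm_biproduct_cancel:
  assumes bp: "pm_biproduct M N C i a j b" and bp': "pm_biproduct M G D i' a' j' b'"
    and iso: "pm_iso N G (\<lambda>p v. a' p (i p v))"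
  shows "pm_iso D C (\<lambda>p d. b p (j' p d))"
  unfolding pm_iso_def
proof (intro conjI allI)
  note B = pm_biproductD[OF bp] and B' = pm_biproductD[OF bp']
  note M = pm_hom_source[OF B(2)] and D = pm_hom_source[OF B'(3)]
  note hom_iso = pm_iso_hom[OF iso]
  show hom: "pm_hom D C (\<lambda>p d. b p (j' p d))" by (rule pm_hom_comp[OF B'(3) B(4)])
  \<comment> \<open>A vector of \<open>D\<close> in the kernel also lies in \<open>N\<close> and projects to zero in \<open>G\<close>.\<close>
  have kernel: "d = 0" if d: "d \<in> pm_at D p" and bd: "b p (j' p d) = 0" for p d
  proof -
    define n where "n = a p (j' p d)"
    have n: "n \<in> pm_at N p"
      unfolding n_def by (intro pm_hom_in[OF B(2)] pm_hom_in[OF B'(3)] d)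
    have "i p n = j' p d"
      using B(7)[OF pm_hom_in[OF B'(3) d]] bd pm_hom_zero[OF B(3)] by (simp add: n_def)
    moreover from this have "a' p (i p n) = a' p (i p 0)"
      using pm_biproduct_orthogonal(1)[OF bp' d] pm_hom_zero[OF hom_iso, of p] by simp
    ultimately have "j' p d = 0"
      using inj_onD[OF bij_betw_imp_inj_on[OF pm_iso_bij[OF iso]] _ n pm_zero_in[OF pm_hom_source[OF B(1)]]]
        pm_hom_zero[OF B(1)] by simp
    then show ?thesis using B'(6)[OF d] pm_hom_zero[OF B'(4)] by simp
  qed
  show "bij_betw (\<lambda>d. b p (j' p d)) (pm_at D p) (pm_at C p)" for p
    unfolding bij_betw_def
  proof (intro conjI inj_onI equalityI subsetI)
    fix d e assume de: "d \<in> pm_at D p" "e \<in> pm_at D p" and "b p (j' p d) = b p (j' p e)"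
    then have "b p (j' p (d - e)) = 0" using pm_hom_diff[OF hom de] by simp
    then show "d = e" using kernel[OF pm_diff_in[OF D de]] by simp
  next
    fix c assume c: "c \<in> pm_at C p"
    have "a' p (j p c) \<in> pm_at G p" by (intro pm_hom_in[OF B'(2)] pm_hom_in[OF B(3)] c)
    then obtain n where n: "n \<in> pm_at N p" "a' p (i p n) = a' p (j p c)"
      using bij_betw_imp_surj_on[OF pm_iso_bij[OF iso, of p]] by (metis imageE)
    \<comment> \<open>Correct \<open>c\<close> by a vector of \<open>N\<close> to move it into \<open>D\<close>; the projection to \<open>C\<close> does not see this.\<close>
    define u where "u = j p c - i p n"
    have jc: "j p c \<in> pm_at M p" and i_n: "i p n \<in> pm_at M p"
      using c n(1) by (simp_all add: pm_hom_in[OF B(1)] pm_hom_in[OF B(3)])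
    then have u: "u \<in> pm_at M p" by (simp add: u_def pm_diff_in[OF M])
    have "a' p u = 0"
      using n(2) by (simp add: u_def pm_hom_diff[OF B'(2) jc i_n])
    then have "j' p (b' p u) = u"
      using B'(7)[OF u] pm_hom_zero[OF B'(1)] by simp
    moreover have "b p u = c"
      using pm_biproduct_orthogonal(2)[OF bp n(1)] B(6)[OF c]
      by (simp add: u_def pm_hom_diff[OF B(4) jc i_n])
    ultimately show "c \<in> (\<lambda>d. b p (j' p d)) ` pm_at D p"
      using pm_hom_in[OF B'(4) u] by (intro image_eqI[of _ _ "b' p u"]) auto
  qed (use pm_hom_in[OF hom] in blast)
qed

section \<open>Sums of lists of modules\<close>

lemma pm_list_sum_simps:
  "pm_scale (pm_list_sum s Gs) = (\<lambda>c v i. s c (v i))"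
  "v \<in> pm_at (pm_list_sum s Gs) p \<longleftrightarrow>
     (\<forall>i < length Gs. v i \<in> pm_at (Gs ! i) p) \<and> (\<forall>i \<ge> length Gs. v i = 0)"
  "pm_map (pm_list_sum s Gs) p q v = (\<lambda>i. if i < length Gs then pm_map (Gs ! i) p q (v i) else 0)"
  by (simp_all add: pm_list_sum_def)

lemma pm_list_sum_biproduct:
  fixes s :: "'k::field \<Rightarrow> 'w::ab_group_add \<Rightarrow> 'w" and Gs :: "('p::{finite,order}, 'k, 'w) pmod list"
  assumes L: "persistence_module (pm_list_sum s Gs)"
    and Gs: "\<And>G. G \<in> set Gs \<Longrightarrow> persistence_module G \<and> pm_scale G = s"
    and j: "j < length Gs"
  shows "pm_biproduct (pm_list_sum s Gs) (Gs ! j) (pm_list_sum s (take j Gs @ drop (Suc j) Gs))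
    (\<lambda>p g k. if k = j then g else 0) (\<lambda>p x. x j)
    (\<lambda>p d k. if k < j then d k else if k = j then 0 else d (k - 1))
    (\<lambda>p x k. if k < j then x k else x (Suc k))"
proof -
  define L' where "L' = pm_list_sum s Gs"
  define rest where "rest = take j Gs @ drop (Suc j) Gs"
  \<comment> \<open>Removing the entry \<open>j\<close> of a vector moves the later entries down by one index.\<close>
  define D where "D = pm_list_sum s rest"
  define ins where "ins d k = (if k < j then d k else if k = j then 0 else d (k - 1))"
    for d :: "nat \<Rightarrow> 'w" and k
  define del where "del x k = (if k < j then x k else x (Suc k))" for x :: "nat \<Rightarrow> 'w" and k
  have L: "persistence_module L'" using L by (simp add: L'_def)
  have len: "length rest = length Gs - 1" using j by (simp add: rest_def)
  have nth: "rest ! k = (if k < j then Gs ! k else Gs ! Suc k)" if "k < length Gs - 1" for k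
    using j that by (simp add: rest_def nth_append)
  have G: "persistence_module (Gs ! k)" "pm_scale (Gs ! k) = s" if "k < length Gs" for k
    using Gs that by simp_all
  interpret S: vector_space s using pm_vector_space[OF G(1)[OF j]] G(2)[OF j] by simp
  have map0: "pm_map (Gs ! k) p q 0 = 0" if "k < length Gs" "p \<le> q" for k p q
    using pm_map_add[OF G(1)[OF that(1)] that(2) pm_zero_in[OF G(1)] pm_zero_in[OF G(1)], OF that(1) that(1)]
    by simp
  have del_ins: "del (ins d) = d" for d by (auto simp: del_def ins_def)
  have ins_in: "ins d \<in> pm_at L' p" if "d \<in> pm_at D p" for p d
  proof -
    have d: "d k \<in> pm_at (if k < j then Gs ! k else Gs ! Suc k) p" if "k < length Gs - 1" for k
      unfolding nth[OF that, symmetric]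
      using \<open>d \<in> pm_at D p\<close> that by (simp add: D_def pm_list_sum_simps len)
    have "ins d k \<in> pm_at (Gs ! k) p" if "k < length Gs" for k
      using d[of k] d[of "k - 1"] that j pm_zero_in[OF G(1)[OF that]]
      by (cases k) (auto simp: ins_def split: if_splits)
    moreover have "ins d k = 0" if "k \<ge> length Gs" for k
      using \<open>d \<in> pm_at D p\<close> that j by (auto simp: ins_def D_def pm_list_sum_simps len)
    ultimately show ?thesis by (simp add: L'_def pm_list_sum_simps)
  qed
  have del_in: "del x \<in> pm_at D p" if "x \<in> pm_at L' p" for p x
    using that j by (auto simp: del_def D_def L'_def pm_list_sum_simps len nth)
  have del: "pm_hom L' D (\<lambda>p. del)"
  proof (rule pm_hom_of_surjection[OF L])
    show "vector_space (pm_scale D)"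
      using pm_vector_space[OF L] by (simp add: D_def L'_def pm_list_sum_simps)
    show "del ` pm_at L' p = pm_at D p" for p
    proof (intro equalityI subsetI)
      show "d \<in> del ` pm_at L' p" if "d \<in> pm_at D p" for d
        using ins_in[OF that] del_ins[of d] by (metis imageI)
    qed (use del_in in blast)
    show "del (pm_map L' p q x) = pm_map D p q (del x)" for p q x
      using j by (auto simp: del_def L'_def D_def pm_list_sum_simps len nth fun_eq_iff)
  qed (auto simp: del_def L'_def D_def pm_list_sum_simps fun_eq_iff)
  have ins: "pm_hom D L' (\<lambda>p. ins)"
  proof (rule pm_homI[OF pm_hom_target[OF del] L ins_in])
    show "ins (pm_map D p q d) = pm_map L' p q (ins d)" if "p \<le> q" for p q d
    proof
      show "ins (pm_map D p q d) k = pm_map L' p q (ins d) k" for k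
        using j that
        by (cases k) (auto simp: ins_def L'_def D_def pm_list_sum_simps len nth map0)
    qed
  qed (auto simp: ins_def L'_def D_def pm_list_sum_simps fun_eq_iff)
  have inj: "pm_hom (Gs ! j) L' (\<lambda>p g k. if k = j then g else 0)"
  proof (rule pm_homI[OF G(1)[OF j] L])
    show "(\<lambda>k. if k = j then g else 0) \<in> pm_at L' p" if "g \<in> pm_at (Gs ! j) p" for p g
      using that j pm_zero_in[OF G(1)] by (auto simp: L'_def pm_list_sum_simps)
  qed (use j in \<open>auto simp: L'_def pm_list_sum_simps G(2) map0\<close>)
  have proj: "pm_hom L' (Gs ! j) (\<lambda>p x. x j)"
    by (rule pm_homI[OF L G(1)[OF j]]) (use j in \<open>auto simp: L'_def pm_list_sum_simps G(2)\<close>)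
  have "pm_biproduct L' (Gs ! j) D (\<lambda>p g k. if k = j then g else 0) (\<lambda>p x. x j) (\<lambda>p. ins) (\<lambda>p. del)"
    unfolding pm_biproduct_def
    by (intro conjI inj proj ins del) (auto simp: del_ins, auto simp: ins_def del_def fun_eq_iff)
  then show ?thesis
    by (simp add: L'_def D_def rest_def ins_def[abs_def] del_def[abs_def])
qed

text \<open>
  A vector \<open>w\<close> of the sum is the sum of its components.  The induction adds them one at a time,
  so that a morphism that kills all of them kills \<open>w\<close>.
\<close>

lemma pm_list_sum_nonzero_component:
  assumes t: "pm_hom (pm_list_sum s Gs) N t" and w: "w \<in> pm_at (pm_list_sum s Gs) p"
    and Gs: "\<And>G. G \<in> set Gs \<Longrightarrow> persistence_module G" and nz: "t p w \<noteq> 0"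
  shows "\<exists>k < length Gs. t p (\<lambda>m. if m = k then w k else 0) \<noteq> 0"
proof (rule ccontr)
  assume "\<not> ?thesis"
  then have z: "t p (\<lambda>m. if m = k then w k else 0) = 0" if "k < length Gs" for k
    using that by blast
  have zero_in: "0 \<in> pm_at (Gs ! k) p" if "k < length Gs" for k
    using pm_zero_in[OF Gs[OF nth_mem[OF that]]] .
  have "t p (\<lambda>m. if m < n then w m else 0) = 0" if "n \<le> length Gs" for n
    using that
  proof (induction n)
    case 0
    then show ?case using pm_hom_zero[OF t, of p] by (simp add: zero_fun_def)
  next
    case (Suc n)
    have "(\<lambda>m. if m < Suc n then w m else 0) =
        (\<lambda>m. if m < n then w m else 0) + (\<lambda>m. if m = n then w n else 0)"
      by (auto simp: fun_eq_iff less_Suc_eq)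
    moreover have "(\<lambda>m. if m < n then w m else 0) \<in> pm_at (pm_list_sum s Gs) p"
      "(\<lambda>m. if m = n then w n else 0) \<in> pm_at (pm_list_sum s Gs) p"
      using w Suc.prems zero_in by (auto simp: pm_list_sum_simps)
    ultimately show ?case
      using Suc z[of n] pm_hom_add[OF t] by simp
  qed
  then have "t p (\<lambda>m. if m < length Gs then w m else 0) = 0"
    by simp
  moreover have "(\<lambda>m. if m < length Gs then w m else 0) = w"
    using w by (auto simp: pm_list_sum_simps fun_eq_iff)
  ultimately show False using nz by simp
qed

section \<open>Exchanging a cyclic summand\<close>

text \<open>
  The identity of \<open>N\<close> is the sum of its factorisations \<open>N \<rightarrow> G \<rightarrow> N\<close> through the members \<open>G\<close>
  of the list.  Each of these is multiplication by a scalar, since the space of \<open>N\<close> in the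
  degree \<open>p\<close> of its generator is a line.  One of the scalars is nonzero, so \<open>N\<close> is a retract of
  the corresponding \<open>G\<close>, hence isomorphic to it.
\<close>

lemma cyclic_summand_exchange:
  fixes M :: "('p::{finite,order}, 'k::field, 'u::ab_group_add) pmod"
    and Gs :: "('p, 'k, 'w::ab_group_add) pmod list"
  assumes bp: "pm_biproduct M N C i a j b" and N: "pm_cyclic N p v"
    and Gs: "pm_decomposition s M Gs"
  shows "\<exists>k < length Gs. N \<cong>\<^sub>p\<^sub>m Gs ! k \<and> pm_decomposition s C (take k Gs @ drop (Suc k) Gs)"
proof -
  define L where "L = pm_list_sum s Gs"
  note B = pm_biproductD[OF bp]
  note PN = pm_cyclic_module[OF N]
  interpret V: vector_space "pm_scale N" using PN by (rule pm_vector_space)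
  have v: "v \<in> pm_at N p" "v \<noteq> 0" using N unfolding pm_cyclic_def by blast+
  have indec: "pm_indecomposable G" and scale: "pm_scale G = s" if "G \<in> set Gs" for G
    using Gs that by (simp_all add: pm_decomposition_def)
  then have G: "persistence_module G \<and> pm_scale G = s" if "G \<in> set Gs" for G
    using that by (simp add: pm_indecomposable_def)
  obtain h where "pm_iso M L h"
    using Gs by (auto simp: pm_decomposition_def pm_isomorphic_def L_def)
  then obtain h' where h: "pm_hom M L h" and h': "pm_hom L M h'"
    and h'h: "\<And>p v. v \<in> pm_at M p \<Longrightarrow> h' p (h p v) = v"
    and hh': "\<And>p w. w \<in> pm_at L p \<Longrightarrow> h p (h' p w) = w"
    using pm_iso_inverse pm_iso_hom by metis
  define w where "w = h p (i p v)"
  have w: "w \<in> pm_at L p"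
    unfolding w_def by (intro pm_hom_in[OF h] pm_hom_in[OF B(1)] v)
  have aw: "a p (h' p w) = v"
    using v by (simp add: w_def h'h pm_hom_in[OF B(1)] B(5))
  obtain k where k: "k < length Gs" and nz: "a p (h' p (\<lambda>m. if m = k then w k else 0)) \<noteq> 0"
    using pm_list_sum_nonzero_component[OF pm_hom_comp[OF h' B(2), unfolded L_def] w[unfolded L_def]]
      G aw v(2) by blast
  define rest where "rest = take k Gs @ drop (Suc k) Gs"
  have "\<exists>i' j' b'. pm_biproduct M (Gs ! k) (pm_list_sum s rest) i' (\<lambda>p u. h p u k) j' b' \<and>
      (\<forall>p g. i' p g = h' p (\<lambda>m. if m = k then g else 0))"
    using pm_biproduct_transport[OF pm_list_sum_biproduct[OF _ G k] h[unfolded L_def] h'[unfolded L_def]]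
      pm_hom_target[OF h] h'h hh' unfolding L_def rest_def by blast
  then obtain i' j' b' where bp': "pm_biproduct M (Gs ! k) (pm_list_sum s rest) i' (\<lambda>p u. h p u k) j' b'"
    and i': "\<And>p g. i' p g = h' p (\<lambda>m. if m = k then g else 0)"
    by blast
  note B' = pm_biproductD[OF bp']
  \<comment> \<open>The composite \<open>N \<rightarrow> Gs ! k \<rightarrow> N\<close> sends \<open>v\<close> to \<open>c v\<close> with \<open>c \<noteq> 0\<close>; dividing by \<open>c\<close> gives a retraction.\<close>
  define \<alpha> where "\<alpha> q n = h q (i q n) k" for q n
  have \<alpha>: "pm_hom N (Gs ! k) \<alpha>"
    unfolding \<alpha>_def[abs_def] by (rule pm_hom_comp[OF B(1) B'(2)])
  have \<beta>: "pm_hom (Gs ! k) N (\<lambda>q g. a q (i' q g))"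
    by (rule pm_hom_comp[OF B'(1) B(2)])
  have "a p (i' p (\<alpha> p v)) \<in> pm_at N p"
    by (intro pm_hom_in[OF \<beta>] pm_hom_in[OF \<alpha>] v)
  then obtain c where c: "a p (i' p (\<alpha> p v)) = pm_scale N c v"
    using pm_cyclic_generates[OF N, of p] pm_map_id[OF PN v(1)] by auto
  have "a p (i' p (\<alpha> p v)) \<noteq> 0"
    using nz[unfolded w_def] by (simp add: i' \<alpha>_def)
  with c have "c \<noteq> 0" by auto
  have "pm_iso N (Gs ! k) \<alpha>"
  proof (rule retract_of_indecomposable[OF indec[OF nth_mem[OF k]] \<alpha> pm_hom_scaled[OF \<beta>, of "inverse c"]])
    show "pm_scale N (inverse c) (a q (i' q (\<alpha> q n))) = n" if "n \<in> pm_at N q" for q n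
      using pm_cyclic_hom_ext[OF N pm_hom_comp[OF \<alpha> pm_hom_scaled[OF \<beta>, of "inverse c"]]
          pm_homI[OF PN PN, of "\<lambda>q n. n"] _ that] c \<open>c \<noteq> 0\<close> by simp
    show "\<not> pm_zero N" using N by (rule pm_cyclic_nonzero)
  qed
  moreover from this have "C \<cong>\<^sub>p\<^sub>m pm_list_sum s rest"
    using pm_isomorphic_sym pm_biproduct_cancel[OF bp bp']
    unfolding \<alpha>_def[abs_def] pm_isomorphic_def by blast
  moreover have "set rest \<subseteq> set Gs"
    using set_take_subset[of k Gs] set_drop_subset[of "Suc k" Gs] by (auto simp: rest_def)
  ultimately show ?thesis
    using k Gs unfolding pm_decomposition_def pm_isomorphic_def rest_def by blast
qed

lemma pm_decomposition_Cons:
  fixes M :: "('p::{finite,order}, 'k::field, 'u::ab_group_add) pmod"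
    and G :: "('p, 'k, 'w::ab_group_add) pmod"
  assumes bp: "pm_biproduct M N C i a j b"
    and G: "pm_scale G = s" "pm_indecomposable G" "\<not> pm_zero G"
    and NG: "N \<cong>\<^sub>p\<^sub>m G" and Fs: "pm_decomposition s C Fs"
  shows "pm_decomposition s M (G # Fs)"
proof -
  note B = pm_biproductD[OF bp]
  note M = pm_hom_source[OF B(2)]
  obtain f where f: "pm_iso N G f" using NG by (auto simp: pm_isomorphic_def)
  obtain g where g: "pm_iso C (pm_list_sum s Fs) g"
    using Fs by (auto simp: pm_decomposition_def pm_isomorphic_def)
  note fh = pm_iso_hom[OF f] and gh = pm_iso_hom[OF g]
  note fa = pm_hom_comp[OF B(2) fh] and gb = pm_hom_comp[OF B(4) gh]
  define h where "h p u = case_nat (f p (a p u)) (g p (b p u))" for p u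
  have mem: "x \<in> pm_at (pm_list_sum s (G # Fs)) p \<longleftrightarrow>
      x 0 \<in> pm_at G p \<and> (\<lambda>k. x (Suc k)) \<in> pm_at (pm_list_sum s Fs) p" for x p
    by (auto simp: pm_list_sum_simps nth_Cons split: nat.splits)
      (metis Suc_le_D Suc_le_mono)+
  have h_in: "h p u \<in> pm_at (pm_list_sum s (G # Fs)) p" if "u \<in> pm_at M p" for p u
    using that pm_hom_in[OF fa] pm_hom_in[OF gb] by (simp add: mem h_def)
  have surj: "h p ` pm_at M p = pm_at (pm_list_sum s (G # Fs)) p" for p
  proof (intro equalityI subsetI)
    fix x assume "x \<in> pm_at (pm_list_sum s (G # Fs)) p"
    then obtain n c where nc: "n \<in> pm_at N p" "f p n = x 0" "c \<in> pm_at C p" "g p c = (\<lambda>k. x (Suc k))"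
      using bij_betw_imp_surj_on[OF pm_iso_bij[OF f, of p]] bij_betw_imp_surj_on[OF pm_iso_bij[OF g, of p]]
      by (metis imageE mem)
    have in_M: "i p n \<in> pm_at M p" "j p c \<in> pm_at M p"
      using nc by (simp_all add: pm_hom_in[OF B(1)] pm_hom_in[OF B(3)])
    have "h p (i p n + j p c) = x"
      using nc in_M pm_biproduct_orthogonal[OF bp]
      by (auto simp: h_def fun_eq_iff pm_hom_add[OF B(2)] pm_hom_add[OF B(4)] B(5,6) split: nat.split)
    then show "x \<in> h p ` pm_at M p"
      using pm_add_in[OF M in_M] by blast
  qed (use h_in in blast)
  have "pm_hom M (pm_list_sum s (G # Fs)) h"
  proof (rule pm_hom_of_surjection[OF M _ surj])
    show "vector_space (pm_scale (pm_list_sum s (G # Fs)))"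
      using pm_vector_space[OF pm_hom_target[OF gh]] by (simp add: pm_list_sum_simps)
    show "h p (u + u') = h p u + h p u'" if "u \<in> pm_at M p" "u' \<in> pm_at M p" for p u u'
      using pm_hom_add[OF fa that] pm_hom_add[OF gb that]
      by (auto simp: h_def fun_eq_iff split: nat.split)
    show "h p (pm_scale M c u) = pm_scale (pm_list_sum s (G # Fs)) c (h p u)"
      if "u \<in> pm_at M p" for p c u
      using pm_hom_scale[OF fa that] pm_hom_scale[OF gb that] G(1)
      by (auto simp: h_def fun_eq_iff pm_list_sum_simps split: nat.split)
    show "h q (pm_map M p q u) = pm_map (pm_list_sum s (G # Fs)) p q (h p u)"
      if "p \<le> q" "u \<in> pm_at M p" for p q u
      using pm_hom_natural[OF fa that] pm_hom_natural[OF gb that]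
      by (auto simp: h_def fun_eq_iff pm_list_sum_simps split: nat.split)
  qed
  moreover have "inj_on (h p) (pm_at M p)" for p
  proof (rule inj_onI)
    fix u u' assume u: "u \<in> pm_at M p" "u' \<in> pm_at M p" and "h p u = h p u'"
    then have "f p (a p u) = f p (a p u')" "g p (b p u) = g p (b p u')"
      by (auto simp: h_def fun_eq_iff split: nat.splits)
    then have "a p u = a p u'" "b p u = b p u'"
      using u inj_onD[OF bij_betw_imp_inj_on[OF pm_iso_bij[OF f]]]
        inj_onD[OF bij_betw_imp_inj_on[OF pm_iso_bij[OF g]]]
        pm_hom_in[OF B(2)] pm_hom_in[OF B(4)] by blast+
    then show "u = u'" using B(7)[OF u(1)] B(7)[OF u(2)] by metis
  qed
  ultimately have "M \<cong>\<^sub>p\<^sub>m pm_list_sum s (G # Fs)"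
    using surj unfolding pm_isomorphic_def pm_iso_def bij_betw_def by blast
  then show ?thesis using G Fs by (simp add: pm_decomposition_def)
qed

section \<open>Linearization\<close>

lemma persistent_setD:
  assumes "persistent_set S"
  shows "finite (ps_at S p)"
    and "p \<le> q \<Longrightarrow> ps_map S p q ` ps_at S p \<subseteq> ps_at S q"
    and "x \<in> ps_at S p \<Longrightarrow> ps_map S p p x = x"
    and "p \<le> q \<Longrightarrow> q \<le> r \<Longrightarrow> x \<in> ps_at S p \<Longrightarrow>
      ps_map S q r (ps_map S p q x) = ps_map S p r x"
  using assms by (simp_all add: persistent_set_def)

lemma ps_homD:
  assumes "ps_hom S T f"
  shows "persistent_set S" "persistent_set T"
    and "f p ` ps_at S p \<subseteq> ps_at T p"
    and "p \<le> q \<Longrightarrow> x \<in> ps_at S p \<Longrightarrow> f q (ps_map S p q x) = ps_map T p q (f p x)"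
  using assms by (simp_all add: ps_hom_def)

lemma free_map_in: "f ` X \<subseteq> Y \<Longrightarrow> free_map X f v \<in> free_space Y"
  by (auto simp: free_map_def free_space_def intro!: sum.neutral)

lemma free_map_add: "free_map X f (v + w) = free_map X f v + free_map X f w"
  by (simp add: free_map_def fun_eq_iff sum.distrib)

lemma free_map_scale: "free_map X f (\<lambda>x. c * v x) = (\<lambda>y. c * free_map X f v y)"
  by (simp add: free_map_def sum_distrib_left)

lemma free_map_eq_sum:
  "finite X \<Longrightarrow> free_map X f v y = (\<Sum>x\<in>X. if f x = y then v x else 0)"
  by (simp add: free_map_def sum.inter_filter)

lemma free_map_cong: "(\<And>x. x \<in> X \<Longrightarrow> f x = g x) \<Longrightarrow> free_map X f v = free_map X g v"
  unfolding free_map_def by (intro ext sum.cong) auto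

lemma free_map_comp:
  assumes "finite X" "finite Y" "f ` X \<subseteq> Y"
  shows "free_map Y g (free_map X f v) = free_map X (\<lambda>x. g (f x)) v"
proof
  fix z
  have "free_map Y g (free_map X f v) z =
      (\<Sum>y\<in>Y. \<Sum>x\<in>X. if g y = z \<and> f x = y then v x else 0)"
    unfolding free_map_eq_sum[OF assms(1)] free_map_eq_sum[OF assms(2)]
    by (intro sum.cong) auto
  also have "\<dots> = (\<Sum>x\<in>X. \<Sum>y\<in>Y. if y = f x then if g (f x) = z then v x else 0 else 0)"
    by (subst sum.swap) (intro sum.cong, auto)
  also have "\<dots> = (\<Sum>x\<in>X. if g (f x) = z then v x else 0)"
    using assms by (intro sum.cong) auto
  finally show "free_map Y g (free_map X f v) z = free_map X (\<lambda>x. g (f x)) v z"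
    by (simp add: free_map_eq_sum[OF assms(1)])
qed

lemma free_map_fixed:
  assumes "finite X" "w \<in> free_space X" "\<And>x. x \<in> X \<Longrightarrow> w x \<noteq> 0 \<Longrightarrow> f x = x"
  shows "free_map X f w = w"
proof
  fix y
  have "free_map X f w y = (\<Sum>x\<in>X. if x = y then w x else 0)"
    unfolding free_map_eq_sum[OF assms(1)] using assms(3) by (intro sum.cong refl) (metis (full_types))
  then show "free_map X f w y = w y"
    using assms(1,2) by (simp add: free_space_def)
qed

definition basis_vector :: "'a \<Rightarrow> 'a \<Rightarrow> 'k::field" where
  "basis_vector x = (\<lambda>y. if y = x then 1 else 0)"

lemma basis_vector_in: "x \<in> X \<Longrightarrow> basis_vector x \<in> free_space X"
  by (auto simp: basis_vector_def free_space_def)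

lemma free_map_basis_vector:
  assumes "finite X" "x \<in> X"
  shows "free_map X f (basis_vector x) = basis_vector (f x)"
proof
  fix y
  have "free_map X f (basis_vector x) y = (\<Sum>z\<in>X. if z = x then if y = f x then 1 else 0 else 0)"
    unfolding free_map_eq_sum[OF assms(1)] by (intro sum.cong) (auto simp: basis_vector_def)
  then show "free_map X f (basis_vector x) y = basis_vector (f x) y"
    using assms by (simp add: basis_vector_def)
qed

lemma vector_space_fun: "vector_space (\<lambda>(c::'k::field) v x. c * v x)"
  by (auto simp: vector_space_def fun_eq_iff algebra_simps)

lemma free_space_spanned:
  assumes "finite X"
  shows "module.span (\<lambda>(c::'k::field) v x. c * v x) (basis_vector ` X) = free_space X"
proof -
  interpret V: vector_space "\<lambda>(c::'k) v (x::'a). c * v x" by (rule vector_space_fun)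
  have sub: "V.subspace (free_space X)"
    by (rule V.subspaceI) (auto simp: free_space_def)
  have "w \<in> V.span (basis_vector ` X)" if "w \<in> free_space X" for w
    using assms that
  proof (induction X arbitrary: w)
    case empty
    then have "w = 0" by (simp add: free_space_def fun_eq_iff)
    then show ?case using V.span_zero by metis
  next
    case (insert x X)
    have "w(x := 0) \<in> V.span (basis_vector ` X)"
      using insert by (auto simp: free_space_def)
    then have "w(x := 0) \<in> V.span (basis_vector ` insert x X)"
      by (rule subsetD[OF V.span_mono, rotated]) blast
    moreover have "(\<lambda>y. w x * basis_vector x y) \<in> V.span (basis_vector ` insert x X)"
      by (intro V.span_scale V.span_base) simp
    ultimately have "w(x := 0) + (\<lambda>y. w x * basis_vector x y) \<in> V.span (basis_vector ` insert x X)"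
      by (rule V.span_add)
    moreover have "w(x := 0) + (\<lambda>y. w x * basis_vector x y) = w"
      by (auto simp: basis_vector_def fun_eq_iff)
    ultimately show ?case by simp
  qed
  moreover have "V.span (basis_vector ` X) \<subseteq> free_space X"
    by (rule V.span_minimal[OF _ sub]) (auto intro: basis_vector_in)
  ultimately show ?thesis by blast
qed

lemma linearization_simps:
  "pm_scale (linearization S) = (\<lambda>c v x. c * v x)"
  "pm_at (linearization S) p = free_space (ps_at S p)"
  "pm_map (linearization S) p q = free_map (ps_at S p) (ps_map S p q)"
  by (simp_all add: linearization_def)

lemma linearization_module:
  assumes S: "persistent_set S"
  shows "persistence_module (linearization S :: ('p::{finite,order}, 'k::field, 'a \<Rightarrow> 'k) pmod)"
  unfolding persistence_module_def linearization_simps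
proof (intro conjI allI impI ballI)
  interpret V: vector_space "\<lambda>(c::'k) v (x::'a). c * v x" by (rule vector_space_fun)
  note D = persistent_setD[OF S]
  show "vector_space (\<lambda>(c::'k) v (x::'a). c * v x)" by (rule vector_space_fun)
  show "V.subspace (free_space (ps_at S p))" for p
    by (rule V.subspaceI) (auto simp: free_space_def)
  show "\<exists>B. finite B \<and> V.span B = free_space (ps_at S p)" for p
    using free_space_spanned[OF D(1)] D(1) by blast
  show "linear_map_on (\<lambda>(c::'k) v x. c * v x) (\<lambda>c v x. c * v x) (free_space (ps_at S p))
      (free_space (ps_at S q)) (free_map (ps_at S p) (ps_map S p q))" if "p \<le> q" for p q
    using free_map_in[OF D(2)[OF that]]
    by (auto simp: linear_map_on_def free_map_add free_map_scale)
  show "free_map (ps_at S p) (ps_map S p p) v = v" if "v \<in> free_space (ps_at S p)"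
    for p and v :: "'a \<Rightarrow> 'k"
    using that by (intro free_map_fixed D) auto
  show "free_map (ps_at S q) (ps_map S q r) (free_map (ps_at S p) (ps_map S p q) v) =
      free_map (ps_at S p) (ps_map S p r) v" if "p \<le> q" "q \<le> r" for p q r and v :: "'a \<Rightarrow> 'k"
    using that by (simp add: free_map_comp[OF D(1) D(1) D(2)] D(4) cong: free_map_cong)
qed

lemma linearization_hom_hom:
  assumes f: "ps_hom S T f"
  shows "pm_hom (linearization S) (linearization T)
    (linearization_hom S f :: 'p::{finite,order} \<Rightarrow> ('a \<Rightarrow> 'k::field) \<Rightarrow> 'b \<Rightarrow> 'k)"
proof -
  note D = ps_homD[OF f]
  note S = persistent_setD[OF D(1)] and T = persistent_setD[OF D(2)]
  show ?thesis
  proof (rule pm_homI[OF linearization_module[OF D(1)] linearization_module[OF D(2)]])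
    show "linearization_hom S f q (pm_map (linearization S) p q v) =
        pm_map (linearization T) p q (linearization_hom S f p v)" if "p \<le> q"
      for p q and v :: "'a \<Rightarrow> 'k"
      using that
      by (simp add: linearization_hom_def linearization_simps free_map_comp[OF S(1) S(1) S(2)]
          free_map_comp[OF S(1) T(1) D(3)] D(4) cong: free_map_cong)
  qed (simp_all add: linearization_hom_def linearization_simps free_map_in[OF D(3)] free_map_add
      free_map_scale)
qed

lemma ps_image_hom:
  assumes f: "ps_hom S T f"
  shows "ps_hom S (ps_image f S T) f" and "ps_hom (ps_image f S T) T (\<lambda>p x. x)"
proof -
  note D = ps_homD[OF f]
  have "persistent_set (ps_image f S T)"
    using D(1,2) D(3) D(4)[symmetric] persistent_setD[OF D(1)] persistent_setD[OF D(2)]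
    unfolding persistent_set_def ps_image_def by (auto simp: image_subset_iff)
  then show "ps_hom S (ps_image f S T) f" "ps_hom (ps_image f S T) T (\<lambda>p x. x)"
    using D by (auto simp: ps_hom_def ps_image_def)
qed

section \<open>The image of the complementary idempotent\<close>

lemma linearization_idempotent:
  assumes \<phi>: "ps_idempotent_endo S \<phi>" and v: "v \<in> pm_at (linearization S) p"
  shows "linearization_hom S \<phi> p (linearization_hom S \<phi> p v) = linearization_hom S \<phi> p v"
proof -
  have h: "ps_hom S S \<phi>" using \<phi> by (simp add: ps_idempotent_endo_def)
  note fin = persistent_setD(1)[OF ps_homD(1)[OF h]]
  show ?thesis
    unfolding linearization_hom_def free_map_comp[OF fin fin ps_homD(3)[OF h]]
    by (rule free_map_cong) (use \<phi> in \<open>simp add: ps_idempotent_endo_def\<close>)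
qed

lemma complement_image_at:
  "pm_at (complement_image S \<phi>) p =
    (\<lambda>v. v - linearization_hom S \<phi> p v) ` pm_at (linearization S) p"
  "pm_scale (complement_image S \<phi>) = pm_scale (linearization S)"
  "pm_map (complement_image S \<phi>) = pm_map (linearization S)"
  by (simp_all add: complement_image_def pm_image_def)

text \<open>
  Linearization preserves the splitting of \<open>\<phi>\<close> into the surjection of \<open>S\<close> onto the image of \<open>\<phi>\<close>
  and the inclusion of that image.  So \<open>L \<phi>\<close> splits with image \<open>L (img \<phi>)\<close>, and \<open>1 - L \<phi>\<close>
  projects onto the other summand.
\<close>

lemma linearization_biproduct:
  assumes \<phi>: "ps_idempotent_endo S \<phi>"
  defines "T \<equiv> ps_image \<phi> S S"
  shows "pm_biproduct (linearization S :: ('p::{finite,order}, 'k::field, 'a \<Rightarrow> 'k) pmod)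
    (complement_image S \<phi>) (linearization T)
    (\<lambda>p v. v) (\<lambda>p v. v - linearization_hom S \<phi> p v)
    (linearization_hom T (\<lambda>p x. x)) (linearization_hom S \<phi>)"
  unfolding pm_biproduct_def
proof (intro conjI allI ballI)
  have h: "ps_hom S S \<phi>" and idem: "\<And>p x. x \<in> ps_at S p \<Longrightarrow> \<phi> p (\<phi> p x) = \<phi> p x"
    using \<phi> by (simp_all add: ps_idempotent_endo_def)
  note to_T = ps_image_hom(1)[OF h, folded T_def] and from_T = ps_image_hom(2)[OF h, folded T_def]
  note e = linearization_hom_hom[OF h]
  note e' = pm_hom_complement[OF e]
  note finS = persistent_setD(1)[OF ps_homD(1)[OF h]]
    and finT = persistent_setD(1)[OF ps_homD(1)[OF from_T]]
  show "pm_hom (complement_image S \<phi>) (linearization S :: ('p, 'k, 'a \<Rightarrow> 'k) pmod) (\<lambda>p v. v)"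
    unfolding complement_image_def by (rule pm_submodule_inclusion[OF pm_image_submodule[OF e']])
  show "pm_hom (linearization S :: ('p, 'k, 'a \<Rightarrow> 'k) pmod) (complement_image S \<phi>)
      (\<lambda>p v. v - linearization_hom S \<phi> p v)"
    unfolding complement_image_def by (rule pm_image_hom[OF e'])
  show "pm_hom (linearization T) (linearization S :: ('p, 'k, 'a \<Rightarrow> 'k) pmod)
      (linearization_hom T (\<lambda>p x. x))"
    by (rule linearization_hom_hom[OF from_T])
  show "pm_hom (linearization S :: ('p, 'k, 'a \<Rightarrow> 'k) pmod) (linearization T)
      (linearization_hom S \<phi>)"
    by (rule linearization_hom_hom[OF to_T])
  show "v - linearization_hom S \<phi> p v = v" if v: "v \<in> pm_at (complement_image S \<phi>) p"
    for p and v :: "'a \<Rightarrow> 'k"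
  proof -
    obtain u where u: "u \<in> pm_at (linearization S) p" "v = u - linearization_hom S \<phi> p u"
      using v by (auto simp: complement_image_at)
    then have "linearization_hom S \<phi> p v = 0"
      by (simp add: pm_hom_diff[OF e] pm_hom_in[OF e] linearization_idempotent[OF \<phi>])
    then show ?thesis by simp
  qed
  show "linearization_hom S \<phi> p (linearization_hom T (\<lambda>p x. x) p w) = w"
    if "w \<in> pm_at (linearization T) p" for p and w :: "'a \<Rightarrow> 'k"
  proof -
    have "free_map (ps_at T p) (\<lambda>x. \<phi> p x) w = w"
      using that idem
      by (intro free_map_fixed[OF finT]) (auto simp: linearization_simps T_def ps_image_def)
    then show ?thesis
      unfolding linearization_hom_def free_map_comp[OF finT finS ps_homD(3)[OF from_T]] .
  qed
  show "u - linearization_hom S \<phi> p u + linearization_hom T (\<lambda>p x. x) p (linearization_hom S \<phi> p u) = u"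
    for p and u :: "'a \<Rightarrow> 'k"
    unfolding linearization_hom_def free_map_comp[OF finS finT ps_homD(3)[OF to_T]] by simp
qed

lemma complement_image_basis_difference:
  assumes \<phi>: "ps_idempotent_endo S \<phi>" and x: "x \<in> ps_at S p"
  shows "basis_vector x - basis_vector (\<phi> p x) \<in> pm_at (complement_image S \<phi>) p"
proof -
  have "finite (ps_at S p)"
    using \<phi> by (simp add: ps_idempotent_endo_def ps_hom_def persistent_set_def)
  then show ?thesis
    unfolding complement_image_at(1) using x
    by (intro image_eqI[of _ _ "basis_vector x"])
      (simp_all add: linearization_hom_def linearization_simps free_map_basis_vector basis_vector_in)
qed

lemma basis_difference_nonzero: "x \<noteq> y \<Longrightarrow> basis_vector x - basis_vector y \<noteq> 0"
  by (auto simp: basis_vector_def fun_eq_iff)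

text \<open>
  Every element is the image of a generator, which is found by descending in the poset as long
  as possible.  An endomorphism that fixes the generator fixes the element, by naturality.
\<close>

lemma nonfixed_comes_from_nonfixed_generator:
  assumes \<phi>: "ps_hom S S \<phi>" and y: "y \<in> ps_at S q" "\<phi> q y \<noteq> y"
  shows "\<exists>(r, z) \<in> nonfixed_generators S \<phi>. r \<le> q \<and> ps_map S r q z = y"
  using y
proof (induction "card {r. r < q}" arbitrary: q y rule: less_induct)
  case less
  note S = persistent_setD[OF ps_homD(1)[OF \<phi>]]
  show ?case
  proof (cases "(q, y) \<in> generators S")
    case True
    then have "(q, y) \<in> nonfixed_generators S \<phi>"
      using less.prems by (simp add: nonfixed_generators_def)
    then show ?thesis using S(3)[OF less.prems(1)] by force
  next
    case False
    then obtain r z where r: "r < q" and z: "z \<in> ps_at S r" "y = ps_map S r q z"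
      using less.prems by (auto simp: generators_def)
    have "\<phi> r z \<noteq> z"
      using ps_homD(4)[OF \<phi> less_imp_le[OF r] z(1)] z less.prems(2) by auto
    moreover have "card {t. t < r} < card {t. t < q}"
      using r by (intro psubset_card_mono) auto
    ultimately obtain t x where t: "(t, x) \<in> nonfixed_generators S \<phi>" "t \<le> r" "ps_map S t r x = z"
      using less.hyps[OF _ z(1)] by blast
    then have "x \<in> ps_at S t" by (simp add: nonfixed_generators_def generators_def)
    then have "ps_map S t q x = y"
      using S(4)[OF t(2) less_imp_le[OF r]] t(3) z(2) by auto
    moreover have "t \<le> q" using t(2) r by simp
    ultimately show ?thesis using t(1) by (intro bexI[of _ "(t, x)"]) simp_all
  qed
qed

text \<open>
  In a degree \<open>q\<close> above \<open>p\<close>, the only element that can be moved is the image \<open>y\<close> of \<open>x\<close>.  So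
  \<open>1 - L \<phi>\<close> kills every basis vector of the space at \<open>q\<close> other than \<open>y\<close>, and sends \<open>y\<close> to
  \<open>y - \<phi> y\<close>, the image of \<open>x - \<phi> x\<close>.  In the remaining degrees nothing is moved.
\<close>

lemma complement_image_cyclic:
  assumes \<phi>: "ps_idempotent_endo S \<phi>" and nf: "nonfixed_generators S \<phi> = {(p, x)}"
  shows "pm_cyclic (complement_image S \<phi> :: ('p::{finite,order}, 'k::field, 'a \<Rightarrow> 'k) pmod) p
    (basis_vector x - basis_vector (\<phi> p x))"
proof -
  let ?N = "complement_image S \<phi> :: ('p, 'k, 'a \<Rightarrow> 'k) pmod"
  let ?v = "basis_vector x - basis_vector (\<phi> p x) :: 'a \<Rightarrow> 'k"
  have h: "ps_hom S S \<phi>" using \<phi> by (simp add: ps_idempotent_endo_def)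
  note S = persistent_setD[OF ps_homD(1)[OF h]]
  note e = linearization_hom_hom[OF h]
  have N: "persistence_module ?N"
    using pm_biproductD(1)[OF linearization_biproduct[OF \<phi>]] by (rule pm_hom_source)
  have x: "x \<in> ps_at S p" and moved: "\<phi> p x \<noteq> x"
    using nf by (auto simp: nonfixed_generators_def generators_def)
  have v: "?v \<in> pm_at ?N p"
    using complement_image_basis_difference[OF \<phi> x] .
  have fixed: "\<phi> q y = y" if "y \<in> ps_at S q" "\<not> (p \<le> q \<and> y = ps_map S p q x)" for q y
    using nonfixed_comes_from_nonfixed_generator[OF h that(1)] that(2) nf by auto
  have above: "pm_at ?N q = range (\<lambda>c. pm_scale ?N c (pm_map ?N p q ?v))" if q: "p \<le> q" for q
  proof
    show "range (\<lambda>c. pm_scale ?N c (pm_map ?N p q ?v)) \<subseteq> pm_at ?N q"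
      using pm_scale_in[OF N pm_map_in[OF N q v]] by blast
    show "pm_at ?N q \<subseteq> range (\<lambda>c. pm_scale ?N c (pm_map ?N p q ?v))"
    proof
      fix n assume "n \<in> pm_at ?N q"
      then obtain w where w: "w \<in> free_space (ps_at S q)" "n = w - linearization_hom S \<phi> q w"
        by (auto simp: complement_image_at linearization_simps)
      define y where "y = ps_map S p q x"
      have y: "y \<in> ps_at S q" using S(2)[OF q] x by (auto simp: y_def)
      have map_v: "pm_map ?N p q ?v = basis_vector y - basis_vector (\<phi> q y)"
      proof -
        have "\<phi> p x \<in> ps_at S p" using ps_homD(3)[OF h] x by blast
        then have "?v \<in> free_space (ps_at S p)" "basis_vector x \<in> (free_space (ps_at S p) :: ('a \<Rightarrow> 'k) set)"
            "basis_vector (\<phi> p x) \<in> (free_space (ps_at S p) :: ('a \<Rightarrow> 'k) set)"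
          using x by (auto simp: free_space_def basis_vector_def)
        moreover have "free_map (ps_at S p) (ps_map S p q) ?v +
            free_map (ps_at S p) (ps_map S p q) (basis_vector (\<phi> p x)) =
            free_map (ps_at S p) (ps_map S p q) (basis_vector x)"
          by (simp add: free_map_add[symmetric])
        ultimately show ?thesis
          using x \<open>\<phi> p x \<in> ps_at S p\<close> ps_homD(4)[OF h q x]
          by (simp add: complement_image_at linearization_simps free_map_basis_vector[OF S(1)]
              y_def eq_diff_eq)
      qed
      \<comment> \<open>All basis vectors occurring in \<open>w'\<close> are fixed, so only the multiple of \<open>y\<close> in \<open>w\<close>
        contributes to \<open>n\<close>.\<close>
      define w' where "w' = w(y := 0)"
      have w': "w' \<in> free_space (ps_at S q)" using w(1) by (auto simp: w'_def free_space_def)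
      have decomp: "w = w' + (\<lambda>z. w y * basis_vector y z)"
        by (auto simp: w'_def basis_vector_def fun_eq_iff)
      have "free_map (ps_at S q) (\<phi> q) w' = w'"
        by (rule free_map_fixed[OF S(1) w'], rule fixed) (auto simp: w'_def y_def split: if_splits)
      then have "linearization_hom S \<phi> q w = w' + (\<lambda>z. w y * basis_vector (\<phi> q y) z)"
        using y by (subst decomp) (simp add: linearization_hom_def free_map_add free_map_scale
            free_map_basis_vector[OF S(1)])
      then have "n = w' + (\<lambda>z. w y * basis_vector y z) - (w' + (\<lambda>z. w y * basis_vector (\<phi> q y) z))"
        using w(2) decomp by metis
      then have "n = pm_scale ?N (w y) (pm_map ?N p q ?v)"
        unfolding map_v by (simp add: complement_image_at linearization_simps fun_eq_iff algebra_simps)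
      then show "n \<in> range (\<lambda>c. pm_scale ?N c (pm_map ?N p q ?v))" by blast
    qed
  qed
  have "pm_at ?N q = {0}" if q: "\<not> p \<le> q" for q
  proof -
    have "n = 0" if n: "n \<in> pm_at ?N q" for n
    proof -
      obtain w where w: "w \<in> free_space (ps_at S q)" "n = w - linearization_hom S \<phi> q w"
        using n by (auto simp: complement_image_at linearization_simps)
      have "linearization_hom S \<phi> q w = w"
        unfolding linearization_hom_def
        by (rule free_map_fixed[OF S(1) w(1)]) (use fixed q in blast)
      then show ?thesis using w(2) by simp
    qed
    then show ?thesis using pm_zero_in[OF N] by blast
  qed
  then show ?thesis
    using N v basis_difference_nonzero[OF moved[symmetric]] above
    unfolding pm_cyclic_def by simp
qed

theorem corollary3p7:
  fixes S :: "('p::{finite,order}, 'a) pset"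
    and s :: "'k::field \<Rightarrow> 'w::ab_group_add \<Rightarrow> 'w"
  assumes "persistent_set S"
    and "vector_space s"
  shows
    "(\<forall>A \<phi>. rooted_subset S A \<longrightarrow> ps_idempotent_endo S \<phi> \<longrightarrow> nonfixed_generators S \<phi> = A \<longrightarrow>
        \<not> pm_zero (complement_image S \<phi> :: ('p, 'k, 'a \<Rightarrow> 'k) pmod) \<and>
        pm_direct_summand (complement_image S \<phi>)
          (linearization S :: ('p, 'k, 'a \<Rightarrow> 'k) pmod)) \<and>
     (\<forall>p x \<phi>. rooted_generator S p x \<longrightarrow> ps_idempotent_endo S \<phi> \<longrightarrow>
        nonfixed_generators S \<phi> = {(p, x)} \<longrightarrow>
        (\<exists>I. interval_subposet I \<and>
           (complement_image S \<phi> :: ('p, 'k, 'a \<Rightarrow> 'k) pmod) \<cong>\<^sub>p\<^sub>m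
             (interval_module I :: ('p, 'k, 'k) pmod)) \<and>
        (\<forall>Gs :: ('p, 'k, 'w) pmod list.
           pm_decomposition s (linearization S :: ('p, 'k, 'a \<Rightarrow> 'k) pmod) Gs \<longrightarrow>
           (\<exists>j < length Gs.
              (complement_image S \<phi> :: ('p, 'k, 'a \<Rightarrow> 'k) pmod) \<cong>\<^sub>p\<^sub>m Gs ! j \<and>
              pm_decomposition s
                (linearization (ps_image \<phi> S S) :: ('p, 'k, 'a \<Rightarrow> 'k) pmod)
                (take j Gs @ drop (Suc j) Gs))) \<and>
        (\<forall>(G :: ('p, 'k, 'w) pmod) Fs.
           pm_scale G = s \<longrightarrow>
           (complement_image S \<phi> :: ('p, 'k, 'a \<Rightarrow> 'k) pmod) \<cong>\<^sub>p\<^sub>m G \<longrightarrow>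
           pm_decomposition s
             (linearization (ps_image \<phi> S S) :: ('p, 'k, 'a \<Rightarrow> 'k) pmod) Fs \<longrightarrow>
           pm_decomposition s (linearization S :: ('p, 'k, 'a \<Rightarrow> 'k) pmod) (G # Fs)))"
proof (intro conjI allI impI)
  fix A \<phi>
  assume A: "rooted_subset S A" and \<phi>: "ps_idempotent_endo S \<phi>"
    and nf: "nonfixed_generators S \<phi> = A"
  have h: "ps_hom S S \<phi>" using \<phi> by (simp add: ps_idempotent_endo_def)
  obtain p x where "(p, x) \<in> A" using A by (auto simp: rooted_subset_def)
  then have x: "x \<in> ps_at S p" "\<phi> p x \<noteq> x"
    using nf by (auto simp: nonfixed_generators_def generators_def)
  then show "\<not> pm_zero (complement_image S \<phi> :: ('p, 'k, 'a \<Rightarrow> 'k) pmod)"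
    using complement_image_basis_difference[OF \<phi> x(1)] basis_difference_nonzero[of x "\<phi> p x"]
    by (metis pm_zero_def singletonD)
  show "pm_direct_summand (complement_image S \<phi>) (linearization S :: ('p, 'k, 'a \<Rightarrow> 'k) pmod)"
    unfolding complement_image_def
    by (rule idempotent_direct_summand[OF linearization_hom_hom[OF h] linearization_idempotent[OF \<phi>]])
next
  fix p x \<phi>
  assume \<phi>: "ps_idempotent_endo S \<phi>" and nf: "nonfixed_generators S \<phi> = {(p, x)}"
  note cyc = complement_image_cyclic[OF \<phi> nf]
  note bp = linearization_biproduct[OF \<phi>]
  show "\<exists>I. interval_subposet I \<and> (complement_image S \<phi> :: ('p, 'k, 'a \<Rightarrow> 'k) pmod) \<cong>\<^sub>p\<^sub>m
      (interval_module I :: ('p, 'k, 'k) pmod)"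
    by (rule pm_cyclic_interval_module[OF cyc])
  show "\<exists>j < length Gs. (complement_image S \<phi> :: ('p, 'k, 'a \<Rightarrow> 'k) pmod) \<cong>\<^sub>p\<^sub>m Gs ! j \<and>
      pm_decomposition s (linearization (ps_image \<phi> S S) :: ('p, 'k, 'a \<Rightarrow> 'k) pmod)
        (take j Gs @ drop (Suc j) Gs)"
    if "pm_decomposition s (linearization S :: ('p, 'k, 'a \<Rightarrow> 'k) pmod) Gs"
    for Gs :: "('p, 'k, 'w) pmod list"
    by (rule cyclic_summand_exchange[OF bp cyc that])
  show "pm_decomposition s (linearization S :: ('p, 'k, 'a \<Rightarrow> 'k) pmod) (G # Fs)"
    if G: "pm_scale G = s" "(complement_image S \<phi> :: ('p, 'k, 'a \<Rightarrow> 'k) pmod) \<cong>\<^sub>p\<^sub>m G"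
      and Fs: "pm_decomposition s (linearization (ps_image \<phi> S S) :: ('p, 'k, 'a \<Rightarrow> 'k) pmod) Fs"
    for G :: "('p, 'k, 'w) pmod" and Fs
  proof -
    obtain g where "pm_cyclic G p g"
      using G(2) pm_cyclic_iso[OF cyc] unfolding pm_isomorphic_def by blast
    then show ?thesis
      using pm_decomposition_Cons[OF bp G(1) _ _ G(2) Fs] pm_cyclic_indecomposable pm_cyclic_nonzero
      by blast
  qed
qed

end
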